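(* Let $\Omega$ be a bounded domain in $\mathbb{R}^{2n}$ with $n\ge2$ (so the dimension is $\ge4$). Suppose $u\in C^2(\Omega)\cap C^0(\bar\Omega)$ is a $C^2$-smooth solution to the $p$-minimal surface equation $$\operatorname{div}\frac{\nabla u-\vec X^{\ast}}{|\nabla u-\vec X^{\ast}|}=0 .$$ Then $u$ is a weak solution to the $p$-minimal surface equation in $\Omega$; and if in addition $u\in W^{1,1}(\Omega)$, then $u$ is a minimizer for $\mathcal{X}(u)=\int_\Omega|\nabla u-\vec X^{\ast}|$.
   Context: Coordinates on $\mathbb{R}^{2n}$ are $\vec X=(x_1,x_{1'},x_2,x_{2'},\dots,x_n,x_{n'})$, and $\vec X^{\ast}=(x_{1'},-x_1,x_{2'},-x_2,\dots,x_{n'},-x_n)$. $S(u)=\{\nabla u-\vec X^{\ast}=0\}$, and $N(u)=\frac{\nabla u-\vec X^{\ast}}{|\nabla u-\vec X^{\ast}|}$ on $\Omega\setminus S(u)$. $u\in C^2(\Omega)$ is a $C^2$-smooth solution if $\operatorname{div}N(u)=0$ holds in $\Omega\setminus S(u)$. A weakly differentiable function $u$ on $\Omega$ is a weak solution to $\operatorname{div}N(u)=0$ in $\Omega$ if for every $\varphi\in C_0^\infty(\Omega)$ $$\int_{S(u)}|\nabla\varphi|+\int_{\Omega\setminus S(u)}N(u)\cdot\nabla\varphi\ge0.$$ $u\in W^{1,1}(\Omega)$ is a minimizer for $\mathcal{X}$ if $\mathcal{X}(u)\le\mathcal{X}(u+\varphi)$ for every $\varphi\in W^{1,1}_0(\Omega)$.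 *)

theory Defs
  imports "HOL-Analysis.Analysis"
begin

text \<open>
  The space \<open>\<real>\<^sup>2\<^sup>n\<close> is rendered as \<^typ>\<open>real^2^'n\<close> with \<open>n = CARD('n)\<close>: the point
  \<open>(x\<^sub>1, x\<^sub>1', \<dots>, x\<^sub>n, x\<^sub>n')\<close> has \<open>x\<^sub>j = X $ j $ 1\<close> and \<open>x\<^sub>j' = X $ j $ 2\<close>.  Its norm, inner
  product and Lebesgue measure are the Euclidean ones in dimension \<open>2n\<close>.
\<close>

definition X_star :: "real^2^'n \<Rightarrow> real^2^'n" where
  "X_star X = (\<chi> j. vector [X $ j $ 2, - (X $ j $ 1)])"

text \<open>
  Only meant for open \<open>S\<close>, where derivatives at points of \<open>S\<close> do not depend on values
  outside \<open>S\<close>.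
\<close>

primrec Ck_on :: "nat \<Rightarrow> ('a::euclidean_space \<Rightarrow> real) \<Rightarrow> 'a set \<Rightarrow> bool" where
  "Ck_on 0 f S \<longleftrightarrow> continuous_on S f"
| "Ck_on (Suc k) f S \<longleftrightarrow>
     (\<forall>x\<in>S. f differentiable (at x)) \<and>
     (\<forall>b\<in>Basis. Ck_on k (\<lambda>x. frechet_derivative f (at x) b) S)"

definition grad :: "('a::euclidean_space \<Rightarrow> real) \<Rightarrow> 'a \<Rightarrow> 'a" where
  "grad f x = (THE D. GDERIV f x :> D)"

definition divergence :: "('a::euclidean_space \<Rightarrow> 'a) \<Rightarrow> 'a \<Rightarrow> real" where
  "divergence F x = (\<Sum>b\<in>Basis. frechet_derivative F (at x) b \<bullet> b)"

text \<open>Elements of \<open>C\<^sub>0\<^sup>\<infinity>(\<Omega>)\<close> are regarded as functions on the whole space.\<close>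

definition test_function :: "'a::euclidean_space set \<Rightarrow> ('a \<Rightarrow> real) \<Rightarrow> bool" where
  "test_function \<Omega> \<phi> \<longleftrightarrow>
     (\<forall>k. Ck_on k \<phi> UNIV) \<and>
     compact (closure {x. \<phi> x \<noteq> 0}) \<and> closure {x. \<phi> x \<noteq> 0} \<subseteq> \<Omega>"

definition locally_integrable_on ::
    "('a::euclidean_space \<Rightarrow> 'b::euclidean_space) \<Rightarrow> 'a set \<Rightarrow> bool" where
  "locally_integrable_on f \<Omega> \<longleftrightarrow>
     (\<forall>K. compact K \<and> K \<subseteq> \<Omega> \<longrightarrow> f absolutely_integrable_on K)"

definition has_weak_grad ::
    "'a::euclidean_space set \<Rightarrow> ('a \<Rightarrow> real) \<Rightarrow> ('a \<Rightarrow> 'a) \<Rightarrow> bool" where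
  "has_weak_grad \<Omega> u g \<longleftrightarrow>
     locally_integrable_on u \<Omega> \<and> locally_integrable_on g \<Omega> \<and>
     (\<forall>\<phi>. test_function \<Omega> \<phi> \<longrightarrow>
        (LINT x:\<Omega>|lebesgue. u x *\<^sub>R grad \<phi> x) = - (LINT x:\<Omega>|lebesgue. \<phi> x *\<^sub>R g x))"

definition weakly_differentiable :: "'a::euclidean_space set \<Rightarrow> ('a \<Rightarrow> real) \<Rightarrow> bool" where
  "weakly_differentiable \<Omega> u \<longleftrightarrow> (\<exists>g. has_weak_grad \<Omega> u g)"

text \<open>
  A weak gradient is determined only up to a null set; the choice of a representative does not
  affect any of the integrals below.
\<close>

definition weak_grad :: "'a::euclidean_space set \<Rightarrow> ('a \<Rightarrow> real) \<Rightarrow> 'a \<Rightarrow> 'a" where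
  "weak_grad \<Omega> u = (SOME g. has_weak_grad \<Omega> u g)"

definition W11 :: "'a::euclidean_space set \<Rightarrow> ('a \<Rightarrow> real) set" where
  "W11 \<Omega> = {u. u absolutely_integrable_on \<Omega> \<and> weakly_differentiable \<Omega> u \<and>
                weak_grad \<Omega> u absolutely_integrable_on \<Omega>}"

definition W11_norm :: "'a::euclidean_space set \<Rightarrow> ('a \<Rightarrow> real) \<Rightarrow> real" where
  "W11_norm \<Omega> u =
     (LINT x:\<Omega>|lebesgue. \<bar>u x\<bar>) + (LINT x:\<Omega>|lebesgue. norm (weak_grad \<Omega> u x))"

definition W11_0 :: "'a::euclidean_space set \<Rightarrow> ('a \<Rightarrow> real) set" where
  "W11_0 \<Omega> = {\<phi> \<in> W11 \<Omega>. \<exists>\<psi> :: nat \<Rightarrow> 'a \<Rightarrow> real.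
      (\<forall>k. test_function \<Omega> (\<psi> k)) \<and>
      (\<lambda>k. W11_norm \<Omega> (\<lambda>x. \<phi> x - \<psi> k x)) \<longlonglongrightarrow> 0}"

text \<open>
  The singular set and the field \<open>N\<close> take the gradient field \<open>g\<close> of \<open>u\<close> as argument, so that
  they serve both the classical gradient of a \<open>C\<^sup>2\<close> function and the weak gradient.
\<close>

definition sing_set :: "(real^2^'n) set \<Rightarrow> (real^2^'n \<Rightarrow> real^2^'n) \<Rightarrow> (real^2^'n) set" where
  "sing_set \<Omega> g = {x\<in>\<Omega>. g x - X_star x = 0}"

definition N_field :: "(real^2^'n \<Rightarrow> real^2^'n) \<Rightarrow> real^2^'n \<Rightarrow> real^2^'n" where
  "N_field g x = (g x - X_star x) /\<^sub>R norm (g x - X_star x)"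

definition C2_solution :: "(real^2^'n) set \<Rightarrow> (real^2^'n \<Rightarrow> real) \<Rightarrow> bool" where
  "C2_solution \<Omega> u \<longleftrightarrow>
     Ck_on 2 u \<Omega> \<and>
     (\<forall>x \<in> \<Omega> - sing_set \<Omega> (grad u). divergence (N_field (grad u)) x = 0)"

definition weak_solution :: "(real^2^'n) set \<Rightarrow> (real^2^'n \<Rightarrow> real) \<Rightarrow> bool" where
  "weak_solution \<Omega> u \<longleftrightarrow>
     weakly_differentiable \<Omega> u \<and>
     (\<forall>\<phi>. test_function \<Omega> \<phi> \<longrightarrow>
        (LINT x : sing_set \<Omega> (weak_grad \<Omega> u) | lebesgue. norm (grad \<phi> x)) +
        (LINT x : \<Omega> - sing_set \<Omega> (weak_grad \<Omega> u) | lebesgue.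
           N_field (weak_grad \<Omega> u) x \<bullet> grad \<phi> x) \<ge> 0)"

definition X_energy :: "(real^2^'n) set \<Rightarrow> (real^2^'n \<Rightarrow> real) \<Rightarrow> real" where
  "X_energy \<Omega> u = (LINT x:\<Omega>|lebesgue. norm (weak_grad \<Omega> u x - X_star x))"

definition is_minimizer :: "(real^2^'n) set \<Rightarrow> (real^2^'n \<Rightarrow> real) \<Rightarrow> bool" where
  "is_minimizer \<Omega> u \<longleftrightarrow>
     u \<in> W11 \<Omega> \<and> (\<forall>\<phi> \<in> W11_0 \<Omega>. X_energy \<Omega> u \<le> X_energy \<Omega> (\<lambda>x. u x + \<phi> x))"

end

(*
  At a point p of the singular set the derivative of F = grad u - X_star is H - J with H symmetric and J
  the nondegenerate skew map X_star; as the dimension is at least 4, such a map has rank at least 2.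
  Hence the set where |F| < e has measure O(e^2) locally: about e^-2 disjoint translates of it, along
  a lattice in a plane on which F' p is injective, fit into a fixed ball.  The field
  F / sqrt (|F|^2 + e^2) is C^1 on all of \<Omega>, and div N = 0 bounds its divergence by a multiple of
  e^2 / (|F|^2 + e^2)^(3/2), whose integral over compact sets tends to 0 with e by the measure
  estimate.  So N is divergence free across the singular set in the sense of distributions.
  Minimality follows by integrating |F + grad phi| >= |F| + N . grad phi and by density of the
  test functions in W11_0.
*)
theory Submission
  imports Defs "HOL-Computational_Algebra.Polynomial"
begin

section \<open>Gradients and integration by parts\<close>

text \<open>In dimension 2 the derivative of F can have rank one; the singular set may then be a
  line across which N jumps, and the jump can carry divergence. The exponent 2 in the measure
  estimate is what rules this out: the divergence of the regularized field can be of order 1/e where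
  |F| < e, so a set of measure O(e) could leave a contribution of order one, while O(e^2) makes it
  vanish. Volumes of sublevel sets, rather than the dimension of the zero set, are estimated because
  then only volume integrals occur and no flux through the boundary of a neighbourhood of the
  singular set has to be controlled. A second obstacle is that the notions of the statement speak of
  \<open>weak_grad\<close>, an unspecified representative of a class modulo null sets. Replacing it
  by \<open>grad u\<close> almost everywhere rests on the uniqueness of weak gradients, which is the
  purpose of the smooth bump functions and of the fundamental lemma of the calculus of
  variations.\<close>

lemma Ck_on_imp_continuous_on: "Ck_on k f S \<Longrightarrow> continuous_on S f"
  by (cases k) (simp_all add: continuous_at_imp_continuous_on differentiable_imp_continuous_within)

text \<open>Riesz representation by the values on \<open>Basis\<close>. Since \<open>grad\<close> is
  a definite description, uniqueness of the representing vector is part of the argument.\<close>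

lemma has_derivative_grad:
  fixes f :: "'a::euclidean_space \<Rightarrow> real"
  assumes "f differentiable (at x)"
  shows "(f has_derivative (\<lambda>h. grad f x \<bullet> h)) (at x)"
proof -
  let ?f' = "frechet_derivative f (at x)"
  have f': "(f has_derivative ?f') (at x)"
    using assms frechet_derivative_works by blast
  have lin: "linear ?f'"
    using f' has_derivative_linear by blast
  have "?f' h = h \<bullet> (\<Sum>b\<in>Basis. ?f' b *\<^sub>R b)" for h
  proof -
    have "?f' h = ?f' (\<Sum>b\<in>Basis. (h \<bullet> b) *\<^sub>R b)"
      by (simp only: euclidean_representation)
    also have "\<dots> = h \<bullet> (\<Sum>b\<in>Basis. ?f' b *\<^sub>R b)"
      by (simp only: linear_sum[OF lin] linear_scale[OF lin] inner_sum_right inner_scaleR_right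
          real_scaleR_def mult.commute)
    finally show ?thesis .
  qed
  then obtain D where "?f' h = h \<bullet> D" for h by blast
  then have D: "GDERIV f x :> D"
    using f' unfolding gderiv_def by presburger
  have "D' = D" if "GDERIV f x :> D'" for D'
    using has_derivative_unique[OF that[unfolded gderiv_def] D[unfolded gderiv_def]]
    by (metis vector_eq_ldot)
  with D have "GDERIV f x :> grad f x"
    unfolding grad_def by (metis theI)
  then show ?thesis
    unfolding gderiv_def by (simp add: inner_commute)
qed

lemma frechet_derivative_eq_grad:
  fixes f :: "'a::euclidean_space \<Rightarrow> real"
  shows "f differentiable (at x) \<Longrightarrow> frechet_derivative f (at x) h = grad f x \<bullet> h"
  using has_derivative_grad frechet_derivative_at by metis

lemma continuous_on_grad:
  fixes f :: "'a::euclidean_space \<Rightarrow> real"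
  assumes "Ck_on (Suc k) f S"
  shows "continuous_on S (grad f)"
proof -
  have "continuous_on S (\<lambda>x. grad f x \<bullet> b)" if "b \<in> Basis" for b
  proof -
    have "continuous_on S (\<lambda>x. frechet_derivative f (at x) b)"
      using assms that by (auto intro: Ck_on_imp_continuous_on)
    then show ?thesis
      by (rule continuous_on_eq) (use assms in \<open>simp add: frechet_derivative_eq_grad\<close>)
  qed
  then show ?thesis
    by (subst continuous_on_componentwise) auto
qed

text \<open>The open sets \<Omega> and \<open>- K\<close> cover the space, and the extension is
  continuous on each. Products with test functions thus live on the whole space, however the other
  factor behaves near the boundary of \<Omega>.\<close>

lemma continuous_on_zero_extension:
  fixes g :: "'a::topological_space \<Rightarrow> 'b::real_normed_vector"
  assumes "open \<Omega>" "closed K" "K \<subseteq> \<Omega>" "continuous_on \<Omega> g" "\<And>x. x \<in> \<Omega> - K \<Longrightarrow> g x = 0"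
  shows "continuous_on UNIV (\<lambda>x. if x \<in> \<Omega> then g x else 0)"
proof -
  let ?g = "\<lambda>x. if x \<in> \<Omega> then g x else 0"
  have "continuous_on \<Omega> ?g"
    using assms(4) by (rule continuous_on_eq) auto
  moreover have "continuous_on (- K) ?g"
    by (rule continuous_on_eq[OF continuous_on_const[of _ 0]]) (use assms in auto)
  ultimately have "continuous_on (\<Omega> \<union> - K) ?g"
    using assms by (intro continuous_on_open_Un) auto
  moreover have "\<Omega> \<union> - K = UNIV" using assms by auto
  ultimately show ?thesis by simp
qed

lemma has_derivative_zero_extension:
  fixes f :: "'a::real_normed_vector \<Rightarrow> 'b::real_normed_vector"
  assumes "open \<Omega>" "closed K" "K \<subseteq> \<Omega>"
    and f: "\<And>x. x \<in> \<Omega> \<Longrightarrow> (f has_derivative f' x) (at x)" and "\<And>x. x \<in> \<Omega> - K \<Longrightarrow> f x = 0"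
  shows "((\<lambda>x. if x \<in> \<Omega> then f x else 0) has_derivative (\<lambda>h. if x \<in> \<Omega> then f' x h else 0)) (at x)"
proof (cases "x \<in> \<Omega>")
  case True
  then show ?thesis
    using has_derivative_transform_within_open[OF f[OF True] \<open>open \<Omega>\<close> True] by simp
next
  case False
  have "((\<lambda>x. if x \<in> \<Omega> then f x else 0) has_derivative (\<lambda>h. 0)) (at x)"
    by (rule has_derivative_transform_within_open[OF has_derivative_const[of 0], of "- K"])
      (use assms False in auto)
  then show ?thesis using False by simp
qed

lemma has_derivative_eq_0_outside:
  assumes "(f has_derivative f') (at x)" "closed K" "\<And>x. x \<notin> K \<Longrightarrow> f x = 0" "x \<notin> K"
  shows "f' = (\<lambda>h. 0)"
proof -
  have "(f has_derivative (\<lambda>h. 0)) (at x)"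
    by (rule has_derivative_transform_within_open[OF has_derivative_const[of 0], of "- K"])
      (use assms in auto)
  then show ?thesis using assms(1) has_derivative_unique by blast
qed

section \<open>Integrals of compactly supported functions\<close>

lemma integrable_continuous_compact_support:
  fixes g :: "'a::euclidean_space \<Rightarrow> 'b::{banach, second_countable_topology}"
  assumes "continuous_on UNIV g" "compact K" "\<And>x. x \<notin> K \<Longrightarrow> g x = 0"
  shows "integrable lborel g"
proof -
  have "integrable lborel (\<lambda>x. indicator K x *\<^sub>R g x)"
    using assms by (intro borel_integrable_compact continuous_on_subset[OF assms(1)]) auto
  also have "(\<lambda>x. indicator K x *\<^sub>R g x) = g"
    using assms(3) by (auto simp: indicator_def)
  finally show ?thesis .
qed

text \<open>Bridge from the set integrals over \<open>lebesgue\<close> used in the definitions to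
  whole-space integrals over \<open>lborel\<close>, where translation invariance is at hand.\<close>

lemma set_lebesgue_integral_compact_support:
  fixes g :: "'a::euclidean_space \<Rightarrow> 'b::{banach, second_countable_topology}"
  assumes "open \<Omega>" "compact K" "K \<subseteq> \<Omega>" "continuous_on \<Omega> g" "\<And>x. x \<in> \<Omega> - K \<Longrightarrow> g x = 0"
  shows set_integrable_compact_support: "set_integrable lebesgue \<Omega> g"
    and "(LINT x:\<Omega>|lebesgue. g x) = (LINT x|lborel. (if x \<in> \<Omega> then g x else 0))"
proof -
  let ?g = "\<lambda>x. if x \<in> \<Omega> then g x else 0"
  have c: "continuous_on UNIV ?g"
    using assms by (intro continuous_on_zero_extension[of _ K]) (auto intro: compact_imp_closed)
  then have i: "integrable lborel ?g"
    by (rule integrable_continuous_compact_support[OF _ assms(2)]) (use assms in auto)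
  have eq: "(\<lambda>x. indicator \<Omega> x *\<^sub>R g x) = ?g"
    by (auto simp: indicator_def)
  have m: "?g \<in> borel_measurable lborel"
    using i by auto
  show "set_integrable lebesgue \<Omega> g"
    unfolding set_integrable_def eq using i m by (simp add: integrable_completion)
  show "(LINT x:\<Omega>|lebesgue. g x) = (LINT x|lborel. ?g x)"
    unfolding set_lebesgue_integral_def eq using m by (simp add: integral_completion)
qed

section \<open>Integration by parts against test functions\<close>

lemma has_field_derivative_along_line:
  fixes f :: "'a::real_normed_vector \<Rightarrow> real"
  assumes "(f has_derivative f') (at (p + t *\<^sub>R v))"
  shows "((\<lambda>t. f (p + t *\<^sub>R v)) has_field_derivative f' v) (at t)"
proof -
  have "((\<lambda>t. f (p + t *\<^sub>R v)) has_derivative (\<lambda>h. f' (h *\<^sub>R v))) (at t)"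
    by (rule has_derivative_compose[where f = "\<lambda>t. p + t *\<^sub>R v" and g = f, OF _ assms]) (auto intro!: derivative_eq_intros)
  moreover have "f' (h *\<^sub>R v) = f' v * h" for h
    using linear_scale[OF has_derivative_linear[OF assms]] by (simp add: mult.commute)
  ultimately show ?thesis
    by (simp add: has_field_derivative_def)
qed

text \<open>The difference quotients in direction \<open>b\<close> have integral zero by translation invariance.\<close>

lemma integral_directional_derivative_eq_0:
  fixes f :: "'a::euclidean_space \<Rightarrow> real"
  assumes f: "\<And>x. (f has_derivative f' x) (at x)" and cont: "continuous_on UNIV (\<lambda>x. f' x b)"
    and K: "compact K" and f0: "\<And>x. x \<notin> K \<Longrightarrow> f x = 0"
  shows "(LINT x|lborel. f' x b) = 0"
proof -
  have f'0: "f' x b = 0" if "x \<notin> K" for x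
    using has_derivative_eq_0_outside[OF f compact_imp_closed[OF K] f0 that] by auto
  have contf: "continuous_on UNIV f"
    by (intro continuous_at_imp_continuous_on ballI has_derivative_continuous[OF f])
  have int_f: "integrable lborel f"
    using contf K f0 by (rule integrable_continuous_compact_support)
  obtain M where "\<And>x. x \<in> K \<Longrightarrow> norm (f' x b) \<le> M"
    using compact_imp_bounded[OF compact_continuous_image[OF continuous_on_subset[OF cont] K]]
    unfolding bounded_iff by auto
  \<comment> \<open>\<open>M\<close> controls only the points of \<open>K\<close> and may be
    negative when \<open>K\<close> is empty, hence the maximum.\<close>
  then have M: "norm (f' x b) \<le> max M 0" for x
    using f'0[of x] by (cases "x \<in> K") (auto simp: le_max_iff_disj)
  have path: "((\<lambda>s. f (x + s *\<^sub>R b)) has_field_derivative f' (x + s *\<^sub>R b) b) (at s)" for x s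
    by (rule has_field_derivative_along_line[OF f])
  define t :: "nat \<Rightarrow> real" where "t n = 1 / real (Suc n)" for n
  have t: "t n > 0" "t n \<le> 1" for n by (auto simp: t_def)
  define q where "q n x = (f (x + t n *\<^sub>R b) - f x) / t n" for n x
  have shift_int: "integrable lborel (\<lambda>x. f (x + c))"
    and shift: "(LINT x|lborel. f (x + c)) = (LINT x|lborel. f x)" for c
  proof -
    have meas: "f \<in> borel_measurable borel" using contf by (rule borel_measurable_continuous_onI)
    show "integrable lborel (\<lambda>x. f (x + c))"
      using int_f integrable_distr_eq[of "(+) c" lborel borel f] meas
      by (simp add: lborel_distr_plus add.commute)
    show "(LINT x|lborel. f (x + c)) = (LINT x|lborel. f x)"
      using integral_distr[of "(+) c" lborel borel f] meas
      by (simp add: lborel_distr_plus add.commute)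
  qed
  obtain R where R: "\<And>x. x \<in> K \<Longrightarrow> norm x \<le> R"
    using compact_imp_bounded[OF K] unfolding bounded_iff by auto
  have "(LINT x|lborel. q n x) = 0" for n
    unfolding q_def using shift_int int_f by (simp add: shift)
  moreover have "(\<lambda>n. LINT x|lborel. q n x) \<longlonglongrightarrow> (LINT x|lborel. f' x b)"
  proof (rule integral_dominated_convergence)
    \<comment> \<open>Since \<open>t n\<close> is at most 1, a difference quotient can be nonzero
      only within distance \<open>norm b\<close> of \<open>K\<close>; there the mean value bound
      \<open>max M 0\<close> applies.\<close>
    let ?w = "\<lambda>x. indicator (cball 0 (R + norm b)) x *\<^sub>R max M 0"
    show "integrable lborel ?w"
      by (intro borel_integrable_compact) auto
    show "(\<lambda>x. f' x b) \<in> borel_measurable lborel"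
      using cont by (simp add: borel_measurable_continuous_onI)
    show "q n \<in> borel_measurable lborel" for n
      unfolding q_def using shift_int int_f by auto
    show "AE x in lborel. norm (q n x) \<le> ?w x" for n
    proof (rule AE_I2)
      fix x
      have "norm (f (x + t n *\<^sub>R b) - f (x + 0 *\<^sub>R b)) \<le> max M 0 * norm (t n - 0)"
        by (rule field_differentiable_bound[OF convex_UNIV, of "\<lambda>s. f (x + s *\<^sub>R b)"])
          (use path M in \<open>auto simp: has_field_derivative_at_within\<close>)
      then have *: "norm (q n x) \<le> max M 0"
        using t[of n] by (simp add: q_def field_simps)
      have "q n x = 0" if "x \<notin> cball 0 (R + norm b)"
      proof -
        have "norm (t n *\<^sub>R b) \<le> norm b"
          using t[of n] mult_right_mono[of "t n" 1 "norm b"] by simp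
        moreover have "norm x \<le> norm (x + t n *\<^sub>R b) + norm (t n *\<^sub>R b)"
          by (metis add_diff_cancel_right' norm_triangle_ineq4)
        moreover have "R + norm b < norm x" using that by simp
        ultimately have "R < norm x" "R < norm (x + t n *\<^sub>R b)"
          using norm_ge_zero[of b] by linarith+
        then have "x \<notin> K" "x + t n *\<^sub>R b \<notin> K"
          using R by force+
        then show ?thesis by (simp add: q_def f0)
      qed
      then show "norm (q n x) \<le> ?w x"
        using * by (auto simp: indicator_def)
    qed
    show "AE x in lborel. (\<lambda>n. q n x) \<longlonglongrightarrow> f' x b"
    proof (rule AE_I2)
      fix x
      have "t \<longlonglongrightarrow> 0"
        unfolding t_def using LIMSEQ_inverse_real_of_nat by (simp add: inverse_eq_divide)
      then have "filterlim t (at 0) sequentially"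
        using t(1)[THEN less_imp_neq] by (auto simp: filterlim_at)
      moreover have "((\<lambda>h. (f (x + h *\<^sub>R b) - f x) / h) \<longlongrightarrow> f' x b) (at 0)"
        using path[of x 0] by (simp add: DERIV_def)
      ultimately show "(\<lambda>n. q n x) \<longlonglongrightarrow> f' x b"
        unfolding q_def by (rule filterlim_compose[rotated])
    qed
  qed
  ultimately show ?thesis
    by (simp add: LIMSEQ_const_iff)
qed

lemma test_functionD:
  fixes \<phi> :: "'a::euclidean_space \<Rightarrow> real"
  assumes "test_function \<Omega> \<phi>"
  obtains K where "compact K" "K \<subseteq> \<Omega>" "\<And>x. x \<notin> K \<Longrightarrow> \<phi> x = 0" "\<And>x. x \<notin> K \<Longrightarrow> grad \<phi> x = 0"
    "\<And>x. \<phi> differentiable (at x)" "continuous_on UNIV \<phi>" "continuous_on UNIV (grad \<phi>)"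
proof
  let ?K = "closure {x. \<phi> x \<noteq> 0}"
  show "compact ?K" "?K \<subseteq> \<Omega>"
    using assms by (auto simp: test_function_def)
  show 0: "\<phi> x = 0" if "x \<notin> ?K" for x
    using that closure_subset[of "{x. \<phi> x \<noteq> 0}"] by auto
  have C: "Ck_on (Suc 0) \<phi> UNIV"
    using assms by (metis test_function_def)
  then show d: "\<phi> differentiable (at x)" for x
    by simp
  show "continuous_on UNIV \<phi>" "continuous_on UNIV (grad \<phi>)"
    using C Ck_on_imp_continuous_on continuous_on_grad by blast+
  show "grad \<phi> x = 0" if "x \<notin> ?K" for x
  proof -
    have "(\<lambda>h. grad \<phi> x \<bullet> h) = (\<lambda>h. 0)"
      by (rule has_derivative_eq_0_outside[OF has_derivative_grad[OF d] closed_closure 0 that])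
    then have "grad \<phi> x \<bullet> grad \<phi> x = 0" by (rule fun_cong)
    then show ?thesis by simp
  qed
qed

text \<open>The product of \<open>f\<close> and \<open>\<phi>\<close>, extended by zero, is
  differentiable on the whole space with support in a compact set, so its derivative in direction
  \<open>b\<close> has integral 0. The product rule splits this into the two sides.\<close>

lemma integral_by_parts_test_function:
  fixes f :: "'a::euclidean_space \<Rightarrow> real"
  assumes \<Omega>: "open \<Omega>" and f: "\<And>x. x \<in> \<Omega> \<Longrightarrow> (f has_derivative f' x) (at x)"
    and f': "continuous_on \<Omega> (\<lambda>x. f' x b)" and \<phi>: "test_function \<Omega> \<phi>"
  shows "(LINT x:\<Omega>|lebesgue. f x * (grad \<phi> x \<bullet> b)) = - (LINT x:\<Omega>|lebesgue. \<phi> x * f' x b)"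
proof -
  obtain K where K: "compact K" "K \<subseteq> \<Omega>" "\<And>x. x \<notin> K \<Longrightarrow> \<phi> x = 0" "\<And>x. x \<notin> K \<Longrightarrow> grad \<phi> x = 0"
    and d: "\<And>x. \<phi> differentiable (at x)" and c: "continuous_on UNIV \<phi>" "continuous_on UNIV (grad \<phi>)"
    using test_functionD[OF \<phi>] by blast
  note c\<Omega> = continuous_on_subset[OF c(1) subset_UNIV] continuous_on_subset[OF c(2) subset_UNIV]
  have cf: "continuous_on \<Omega> f"
    by (intro continuous_at_imp_continuous_on ballI has_derivative_continuous[OF f])
  let ?D = "\<lambda>x h. f x * (grad \<phi> x \<bullet> h) + f' x h * \<phi> x"
  have cD: "continuous_on \<Omega> (\<lambda>x. ?D x b)"
    by (intro continuous_intros cf c\<Omega> f')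
  have "(LINT x:\<Omega>|lebesgue. ?D x b) = (LINT x|lborel. (if x \<in> \<Omega> then ?D x b else 0))"
    using \<Omega> K cD by (intro set_lebesgue_integral_compact_support[of _ K]) auto
  also have "\<dots> = 0"
  proof (rule integral_directional_derivative_eq_0[of "\<lambda>x. if x \<in> \<Omega> then f x * \<phi> x else 0" _ b K])
    show "((\<lambda>x. if x \<in> \<Omega> then f x * \<phi> x else 0) has_derivative (\<lambda>h. if x \<in> \<Omega> then ?D x h else 0)) (at x)" for x
      using \<Omega> K by (intro has_derivative_zero_extension[of _ K])
        (auto intro!: compact_imp_closed has_derivative_mult f has_derivative_grad d)
    show "continuous_on UNIV (\<lambda>x. if x \<in> \<Omega> then ?D x b else 0)"
      using \<Omega> K cD by (intro continuous_on_zero_extension[of _ K]) (auto intro: compact_imp_closed)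
  qed (use K in auto)
  finally have "(LINT x:\<Omega>|lebesgue. ?D x b) = 0" .
  moreover have "set_integrable lebesgue \<Omega> (\<lambda>x. f x * (grad \<phi> x \<bullet> b))"
    "set_integrable lebesgue \<Omega> (\<lambda>x. f' x b * \<phi> x)"
    using \<Omega> K by (intro set_integrable_compact_support[of _ K] continuous_intros cf c\<Omega> f'; auto)+
  ultimately show ?thesis
    by (simp add: set_integral_add mult.commute)
qed

section \<open>Smooth bump functions and the fundamental lemma of the calculus of variations\<close>

lemma Ck_on_SucD: "Ck_on (Suc k) f S \<Longrightarrow> Ck_on k f S"
proof (induction k arbitrary: f)
  case 0
  then show ?case using Ck_on_imp_continuous_on by fastforce
next
  case (Suc k)
  from Suc.prems have "\<forall>x\<in>S. f differentiable at x"
    "\<forall>b\<in>Basis. Ck_on (Suc k) (\<lambda>x. frechet_derivative f (at x) b) S"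
    unfolding Ck_on.simps(2)[of "Suc k"] by blast+
  then show ?case
    using Suc.IH by (subst Ck_on.simps(2)) blast
qed

lemma Ck_on_UNIV_SucI:
  assumes "\<And>x. (f has_derivative f' x) (at x)" "\<And>b. b \<in> Basis \<Longrightarrow> Ck_on k (\<lambda>x. f' x b) UNIV"
  shows "Ck_on (Suc k) f UNIV"
proof -
  have "frechet_derivative f (at x) = f' x" for x
    using frechet_derivative_at[OF assms(1)] by simp
  then show ?thesis
    using assms unfolding Ck_on.simps differentiable_def by auto
qed

lemma Ck_on_SucE:
  assumes "Ck_on (Suc k) f UNIV"
  obtains f' where "\<And>x. (f has_derivative f' x) (at x)" "\<And>b. b \<in> Basis \<Longrightarrow> Ck_on k (\<lambda>x. f' x b) UNIV"
  using assms that[of "\<lambda>x. frechet_derivative f (at x)"] by (simp add: frechet_derivative_works[symmetric])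

lemma Ck_on_const: "Ck_on k (\<lambda>x. c) UNIV"
  by (induction k arbitrary: c) auto

lemma Ck_on_add: "Ck_on k f UNIV \<Longrightarrow> Ck_on k g UNIV \<Longrightarrow> Ck_on k (\<lambda>x. f x + g x) UNIV"
proof (induction k arbitrary: f g)
  case 0
  then show ?case by (simp add: continuous_on_add)
next
  case (Suc k)
  obtain f' g' where "\<And>x. (f has_derivative f' x) (at x)" "\<And>b. b \<in> Basis \<Longrightarrow> Ck_on k (\<lambda>x. f' x b) UNIV"
    "\<And>x. (g has_derivative g' x) (at x)" "\<And>b. b \<in> Basis \<Longrightarrow> Ck_on k (\<lambda>x. g' x b) UNIV"
    using Suc.prems by (metis Ck_on_SucE)
  then show ?case
    by (intro Ck_on_UNIV_SucI[of _ "\<lambda>x h. f' x h + g' x h"] Suc.IH has_derivative_add)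
qed

lemma Ck_on_mult: "Ck_on k f UNIV \<Longrightarrow> Ck_on k g UNIV \<Longrightarrow> Ck_on k (\<lambda>x. f x * g x) UNIV"
proof (induction k arbitrary: f g)
  case 0
  then show ?case by (simp add: continuous_on_mult)
next
  case (Suc k)
  obtain f' g' where "\<And>x. (f has_derivative f' x) (at x)" "\<And>b. b \<in> Basis \<Longrightarrow> Ck_on k (\<lambda>x. f' x b) UNIV"
    "\<And>x. (g has_derivative g' x) (at x)" "\<And>b. b \<in> Basis \<Longrightarrow> Ck_on k (\<lambda>x. g' x b) UNIV"
    using Suc.prems by (metis Ck_on_SucE)
  then show ?case
    \<comment> \<open>The product rule pairs an undifferentiated factor with a derivative of the
      other, so \<open>f\<close> and \<open>g\<close> themselves are needed at order
      \<open>k\<close>.\<close>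
    using Suc.prems[THEN Ck_on_SucD]
    by (intro Ck_on_UNIV_SucI[of _ "\<lambda>x h. f x * g' x h + f' x h * g x"] Ck_on_add Suc.IH
        has_derivative_mult)
qed

lemma Ck_on_prod: "(\<And>i. i \<in> I \<Longrightarrow> Ck_on k (f i) UNIV) \<Longrightarrow> Ck_on k (\<lambda>x. \<Prod>i\<in>I. f i x) UNIV"
  by (induction I rule: infinite_finite_induct) (auto intro: Ck_on_const Ck_on_mult)

text \<open>The functions \<open>p (1/t) exp (-1/t)\<close> with a polynomial \<open>p\<close> are closed under differentiation,
  which gives the smoothness of \<open>exp (-1/t)\<close> at once.\<close>

definition poly_exp_recip :: "real poly \<Rightarrow> real \<Rightarrow> real" where
  "poly_exp_recip p t = (if t \<le> 0 then 0 else poly p (1 / t) * exp (- (1 / t)))"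

lemma tendsto_poly_exp_minus: "((\<lambda>x::real. poly p x * exp (- x)) \<longlongrightarrow> 0) at_top"
proof -
  have "((\<lambda>x. \<Sum>i\<le>degree p. coeff p i * (x ^ i / exp x)) \<longlongrightarrow> (\<Sum>i\<le>degree p. coeff p i * 0)) at_top"
    by (intro tendsto_intros tendsto_power_div_exp_0)
  then show ?thesis
    by (simp add: poly_altdef sum_distrib_right exp_minus divide_inverse mult.assoc)
qed

text \<open>This is the difference quotient at the gluing point 0. With x = 1/t, division by t
  multiplies the polynomial by x, which is \<open>pCons 0 p\<close>.\<close>

lemma poly_exp_recip_div_tendsto_0: "((\<lambda>t. poly_exp_recip p t / t) \<longlongrightarrow> 0) (at 0)"
proof (rule filterlim_split_at)
  have "\<forall>\<^sub>F t in at_left 0. poly_exp_recip p t / t = 0"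
    by (auto simp: poly_exp_recip_def eventually_at intro!: exI[of _ 1])
  then show "((\<lambda>t. poly_exp_recip p t / t) \<longlongrightarrow> 0) (at_left 0)"
    by (simp add: tendsto_eventually)
  have "((\<lambda>t. poly (pCons 0 p) (inverse t) * exp (- inverse t)) \<longlongrightarrow> 0) (at_right 0)"
    by (rule filterlim_compose[OF tendsto_poly_exp_minus filterlim_inverse_at_top_right])
  moreover have "\<forall>\<^sub>F t in at_right 0.
      poly (pCons 0 p) (inverse t) * exp (- inverse t) = poly_exp_recip p t / t"
    by (auto simp: poly_exp_recip_def eventually_at field_simps intro!: exI[of _ 1])
  ultimately show "((\<lambda>t. poly_exp_recip p t / t) \<longlongrightarrow> 0) (at_right 0)"
    by (rule Lim_transform_eventually)
qed

text \<open>The inner derivative of 1/t is -1/t^2. It turns p(x) exp(-x) with x = 1/t into x^2 (p(x)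
  - p'(x)) exp(-x), and \<open>[:0, 0, 1:]\<close> is x^2.\<close>

lemma DERIV_poly_exp_recip:
  "(poly_exp_recip p has_field_derivative poly_exp_recip ([:0, 0, 1:] * (p - pderiv p)) t) (at t)"
proof -
  consider "t < 0" | "t = 0" | "t > 0" by linarith
  then show ?thesis
  proof cases
    case 1
    have "(poly_exp_recip p has_field_derivative 0) (at t)"
      by (rule has_field_derivative_transform_within_open[OF DERIV_const[of 0], of "{..<0}"])
        (use 1 in \<open>auto simp: poly_exp_recip_def\<close>)
    then show ?thesis using 1 by (simp add: poly_exp_recip_def)
  next
    case 2
    then show ?thesis
      using poly_exp_recip_div_tendsto_0[of p] by (simp add: DERIV_def poly_exp_recip_def)
  next
    case 3
    have "((\<lambda>t. poly p (1 / t) * exp (- (1 / t))) has_field_derivative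
        poly_exp_recip ([:0, 0, 1:] * (p - pderiv p)) t) (at t)"
      using 3 by (auto intro!: derivative_eq_intros DERIV_chain2[OF poly_DERIV]
          simp: poly_exp_recip_def field_simps power2_eq_square)
    then show ?thesis
      by (rule has_field_derivative_transform_within_open[of _ _ _ "{0<..}"])
        (use 3 in \<open>auto simp: poly_exp_recip_def\<close>)
  qed
qed

text \<open>The factor \<open>r\<close> lets the induction close: a partial derivative changes the
  polynomial and contributes a constant, the component of \<open>v\<close>.\<close>

lemma Ck_on_poly_exp_recip:
  fixes v :: "'a::euclidean_space"
  shows "Ck_on k (\<lambda>x. r * poly_exp_recip p (x \<bullet> v + d)) UNIV"
proof (induction k arbitrary: p r)
  case 0
  have "continuous_on UNIV (poly_exp_recip p)"
    using DERIV_poly_exp_recip DERIV_isCont by (blast intro: continuous_at_imp_continuous_on)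
  then have "continuous_on UNIV (\<lambda>x. poly_exp_recip p (x \<bullet> v + d))"
    by (rule continuous_on_compose2) (auto intro!: continuous_intros)
  then show ?case by (auto intro!: continuous_intros)
next
  case (Suc k)
  let ?p' = "[:0, 0, 1:] * (p - pderiv p)"
  have "((\<lambda>x. r * poly_exp_recip p (x \<bullet> v + d)) has_derivative
      (\<lambda>h. (r * (h \<bullet> v)) * poly_exp_recip ?p' (x \<bullet> v + d))) (at x)" for x
    by (rule has_derivative_eq_rhs[OF has_derivative_mult_right[OF
        has_derivative_compose[OF _ DERIV_poly_exp_recip[unfolded has_field_derivative_def]]]])
      (auto intro!: derivative_eq_intros)
  then show ?case
    by (rule Ck_on_UNIV_SucI) (rule Suc.IH)
qed

text \<open>Two factors for each coordinate, one per face of the box. The profile exp(-1/t) rises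
  from 0 towards 1, so a large \<open>k\<close> sharpens the bump to the indicator of the open
  box.\<close>

definition box_bump :: "'a::euclidean_space \<Rightarrow> 'a \<Rightarrow> real \<Rightarrow> 'a \<Rightarrow> real" where
  "box_bump a c k x =
    (\<Prod>b\<in>Basis. poly_exp_recip 1 (k * (x \<bullet> b - a \<bullet> b)) * poly_exp_recip 1 (k * (c \<bullet> b - x \<bullet> b)))"

lemma poly_exp_recip_1_bounds: "0 \<le> poly_exp_recip 1 t" "poly_exp_recip 1 t \<le> 1"
  by (auto simp: poly_exp_recip_def)

lemma box_bump_bounds: "0 \<le> box_bump a c k x" "box_bump a c k x \<le> 1"
  unfolding box_bump_def
  by (auto intro!: prod_nonneg prod_le_1 mult_nonneg_nonneg mult_le_one poly_exp_recip_1_bounds)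

lemma box_bump_eq_0:
  assumes "k \<ge> 0" "x \<notin> box a c"
  shows "box_bump a c k x = 0"
proof -
  obtain b where "b \<in> Basis" "x \<bullet> b \<le> a \<bullet> b \<or> c \<bullet> b \<le> x \<bullet> b"
    using assms(2) by (auto simp: mem_box not_less)
  then have "poly_exp_recip 1 (k * (x \<bullet> b - a \<bullet> b)) = 0 \<or> poly_exp_recip 1 (k * (c \<bullet> b - x \<bullet> b)) = 0"
    using assms(1) by (auto simp: poly_exp_recip_def mult_le_0_iff)
  then show ?thesis
    using \<open>b \<in> Basis\<close> unfolding box_bump_def by (intro prod_zero) auto
qed

lemma Ck_on_box_bump: "Ck_on n (box_bump a c k) UNIV"
proof -
  have "Ck_on n (\<lambda>x. poly_exp_recip 1 (k * (x \<bullet> b - a \<bullet> b))) UNIV" for b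
    using Ck_on_poly_exp_recip[of n 1 1 "k *\<^sub>R b" "- k * (a \<bullet> b)"] by (simp add: algebra_simps)
  moreover have "Ck_on n (\<lambda>x. poly_exp_recip 1 (k * (c \<bullet> b - x \<bullet> b))) UNIV" for b
    using Ck_on_poly_exp_recip[of n 1 1 "- k *\<^sub>R b" "k * (c \<bullet> b)"] by (simp add: algebra_simps)
  ultimately show ?thesis
    unfolding box_bump_def by (intro Ck_on_prod Ck_on_mult)
qed

lemma test_function_box_bump:
  assumes "k \<ge> 0" "cbox a c \<subseteq> \<Omega>"
  shows "test_function \<Omega> (box_bump a c k)"
proof -
  have "{x. box_bump a c k x \<noteq> 0} \<subseteq> cbox a c"
    using box_bump_eq_0[OF assms(1)] box_subset_cbox by blast
  then have *: "closure {x. box_bump a c k x \<noteq> 0} \<subseteq> cbox a c"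
    by (intro closure_minimal) auto
  then have "bounded (closure {x. box_bump a c k x \<noteq> 0})"
    using bounded_cbox bounded_subset by blast
  with * show ?thesis
    using assms(2) by (auto simp: test_function_def Ck_on_box_bump compact_eq_bounded_closed)
qed

lemma box_bump_tendsto_indicator: "(\<lambda>n. box_bump a c (real n) x) \<longlonglongrightarrow> indicator (box a c) x"
proof (cases "x \<in> box a c")
  case True
  have lim: "(\<lambda>n. poly_exp_recip 1 (real n * s)) \<longlonglongrightarrow> 1" if "s > 0" for s
  proof -
    have "(\<lambda>n. exp (- (inverse s * inverse (real n)))) \<longlonglongrightarrow> exp (- (inverse s * 0))"
      by (intro tendsto_intros LIMSEQ_inverse_real_of_nat[THEN LIMSEQ_imp_Suc])
    moreover have "\<forall>\<^sub>F n in sequentially.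
        exp (- (inverse s * inverse (real n))) = poly_exp_recip 1 (real n * s)"
      using eventually_gt_at_top[of 0]
      by eventually_elim (use that in \<open>simp add: poly_exp_recip_def field_simps not_le\<close>)
    ultimately have "(\<lambda>n. poly_exp_recip 1 (real n * s)) \<longlonglongrightarrow> exp (- (inverse s * 0))"
      by (rule Lim_transform_eventually)
    then show ?thesis by simp
  qed
  have "(\<lambda>n. box_bump a c (real n) x) \<longlonglongrightarrow> (\<Prod>b\<in>(Basis::'a set). 1 * 1)"
    unfolding box_bump_def using True by (intro tendsto_prod tendsto_mult lim) (auto simp: mem_box)
  then show ?thesis using True by simp
qed (simp add: box_bump_eq_0)

section \<open>From vanishing integrals to vanishing almost everywhere\<close>

lemma locally_integrable_onD:
  assumes "locally_integrable_on g \<Omega>" "compact K" "K \<subseteq> \<Omega>"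
  shows "integrable lebesgue (\<lambda>x. indicator K x *\<^sub>R g x)"
  using assms by (auto simp: locally_integrable_on_def set_integrable_def)

text \<open>The bumps lie between 0 and 1 and converge to the indicator of the open box. Restricted
  to the closed box, a compact subset of \<Omega>, \<open>g\<close> is integrable and its norm
  dominates the products.\<close>

lemma integral_box_eq_0:
  fixes g :: "'a::euclidean_space \<Rightarrow> 'b::euclidean_space"
  assumes g: "locally_integrable_on g \<Omega>" and ac: "cbox a c \<subseteq> \<Omega>"
    and 0: "\<And>\<phi>. test_function \<Omega> \<phi> \<Longrightarrow> (LINT x:\<Omega>|lebesgue. \<phi> x *\<^sub>R g x) = 0"
  shows "(LINT x:box a c|lebesgue. g x) = 0"
proof -
  let ?g = "\<lambda>x. indicator (cbox a c) x *\<^sub>R g x" and ?\<phi> = "\<lambda>n. box_bump a c (real n)"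
  have int: "integrable lebesgue ?g"
    by (rule locally_integrable_onD[OF g compact_cbox ac])
  have "(\<lambda>n. LINT x|lebesgue. ?\<phi> n x *\<^sub>R ?g x) \<longlonglongrightarrow> (LINT x|lebesgue. indicator (box a c) x *\<^sub>R ?g x)"
  proof (rule integral_dominated_convergence)
    show "integrable lebesgue (\<lambda>x. norm (?g x))"
      using int by (rule integrable_norm)
    have "?\<phi> n \<in> borel_measurable borel" for n
      using Ck_on_box_bump[of 0] by (auto intro: borel_measurable_continuous_onI)
    then have "?\<phi> n \<in> borel_measurable lebesgue" for n
      by (simp add: measurable_completion)
    then show "(\<lambda>x. ?\<phi> n x *\<^sub>R ?g x) \<in> borel_measurable lebesgue" for n
      by (rule borel_measurable_scaleR[OF _ borel_measurable_integrable[OF int]])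
    show "(\<lambda>x. indicator (box a c) x *\<^sub>R ?g x) \<in> borel_measurable lebesgue"
      by (rule borel_measurable_scaleR[OF _ borel_measurable_integrable[OF int]])
        (intro borel_measurable_indicator, simp)
    show "AE x in lebesgue. (\<lambda>n. ?\<phi> n x *\<^sub>R ?g x) \<longlonglongrightarrow> indicator (box a c) x *\<^sub>R ?g x"
      by (intro AE_I2 tendsto_intros box_bump_tendsto_indicator)
    show "AE x in lebesgue. norm (?\<phi> n x *\<^sub>R ?g x) \<le> norm (?g x)" for n
      using box_bump_bounds[of a c "real n"] by (intro AE_I2) (auto simp: mult.assoc intro!: mult_left_le_one_le)
  qed
  moreover have "(LINT x|lebesgue. ?\<phi> n x *\<^sub>R ?g x) = 0" for n
  proof -
    have "(\<lambda>x. ?\<phi> n x *\<^sub>R ?g x) = (\<lambda>x. indicator \<Omega> x *\<^sub>R (?\<phi> n x *\<^sub>R g x))"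
      using ac box_bump_eq_0[of "real n" _ a c] box_subset_cbox[of a c]
      by (fastforce simp: indicator_def)
    then show ?thesis
      using 0[OF test_function_box_bump[OF _ ac, of "real n"]] by (simp add: set_lebesgue_integral_def)
  qed
  moreover have "(\<lambda>x. indicator (box a c) x *\<^sub>R ?g x) = (\<lambda>x. indicator (box a c) x *\<^sub>R g x)"
    using box_subset_cbox[of a c] by (fastforce simp: indicator_def)
  ultimately show ?thesis
    by (simp add: LIMSEQ_const_iff set_lebesgue_integral_def)
qed

lemma sigma_finite_lebesgue: "sigma_finite_measure (lebesgue :: 'a::euclidean_space measure)"
proof
  obtain A :: "'a set set" where "countable A" "A \<subseteq> sets lborel" "\<Union>A = space lborel"
    "\<forall>a\<in>A. emeasure lborel a \<noteq> \<infinity>"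
    using lborel.sigma_finite_countable by blast
  then show "\<exists>A :: 'a set set. countable A \<and> A \<subseteq> sets lebesgue \<and> \<Union>A = space lebesgue \<and>
      (\<forall>a\<in>A. emeasure lebesgue a \<noteq> \<infinity>)"
    by (intro exI[of _ A]) (auto simp: subset_iff)
qed

text \<open>A Dynkin argument: boxes form an intersection stable generator of the Borel sets, and
  the sets over which \<open>f\<close> integrates to 0 are closed under complements, thanks to
  \<open>f0\<close>, and under countable disjoint unions. A Lebesgue set differs from a Borel set by
  a null set only.\<close>

lemma AE_eq_0_if_box_integrals_eq_0:
  fixes f :: "'a::euclidean_space \<Rightarrow> 'b::euclidean_space"
  assumes f: "integrable lebesgue f" and f0: "(LINT x|lebesgue. f x) = 0"
    and box: "\<And>l u. (LINT x:box l u|lebesgue. f x) = 0"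
  shows "AE x in lebesgue. f x = 0"
proof -
  have si: "set_integrable lebesgue A f" if "A \<in> sets lebesgue" for A
    using f that by (simp add: set_integrable_def integrable_mult_indicator)
  have borel: "(LINT x:A|lebesgue. f x) = 0" if "A \<in> sets borel" for A
  proof -
    let ?E = "range (\<lambda>(a, b). box a b::'a set)"
    have "Int_stable ?E"
      by (auto simp: Int_stable_def box_Int_box)
    moreover have "?E \<subseteq> Pow UNIV" by simp
    moreover have E: "sigma_sets UNIV ?E = sets borel"
      by (simp add: borel_eq_box)
    then have "A \<in> sigma_sets UNIV ?E" using that by simp
    ultimately show ?thesis
    proof (induction rule: sigma_sets_induct_disjoint)
      case (basic A)
      then show ?case using box by auto
    next
      case empty
      then show ?case by (simp add: set_lebesgue_integral_def)
    next
      case (compl A)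
      then have A: "A \<in> sets lebesgue" using E by auto
      have "UNIV - A \<in> sets lebesgue"
        using sets.compl_sets[OF A] by simp
      then have "(LINT x:UNIV - A|lebesgue. f x) + (LINT x:A|lebesgue. f x) = (LINT x:UNIV|lebesgue. f x)"
        using set_integral_Un[of "UNIV - A" A lebesgue f] si A by (simp add: Int_commute)
      then show ?case using compl f0 by (simp add: set_lebesgue_integral_def)
    next
      case (union A)
      then have A: "A i \<in> sets lebesgue" for i using E by auto
      have "(LINT x:(\<Union>i. A i)|lebesgue. f x) = (\<Sum>i. (LINT x:A i|lebesgue. f x))"
        using A union(1) by (intro lebesgue_integral_countable_add si) (auto simp: disjoint_family_on_def)
      then show ?case using union by simp
    qed
  qed
  have "(LINT x:A|lebesgue. f x) = 0" if A_sets: "A \<in> sets lebesgue" for A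
  proof -
    obtain S N N' where A: "A = S \<union> N" "N \<subseteq> N'" "N' \<in> null_sets lborel" "S \<in> sets lborel"
      using sets_completionE[OF A_sets] by blast
    have N: "AE x in lebesgue. x \<notin> N'"
      using A(3) by (intro AE_not_in null_sets_completionI)
    have "(LINT x:A|lebesgue. f x) = (LINT x:S|lebesgue. f x)"
      unfolding set_lebesgue_integral_def
    proof (rule integral_cong_AE)
      show "AE x in lebesgue. indicat_real A x *\<^sub>R f x = indicat_real S x *\<^sub>R f x"
        using N by eventually_elim (use A in \<open>auto simp: indicator_def\<close>)
    qed (use si[of A] si[of S] A A_sets in \<open>auto simp: set_integrable_def\<close>)
    then show ?thesis using borel A by simp
  qed
  then show ?thesis
    by (rule sigma_finite_measure.density_zero[OF sigma_finite_lebesgue f])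
qed

lemma fundamental_lemma_calculus_of_variations:
  fixes g :: "'a::euclidean_space \<Rightarrow> 'b::euclidean_space"
  assumes \<Omega>: "open \<Omega>" and g: "locally_integrable_on g \<Omega>"
    and 0: "\<And>\<phi>. test_function \<Omega> \<phi> \<Longrightarrow> (LINT x:\<Omega>|lebesgue. \<phi> x *\<^sub>R g x) = 0"
  shows "AE x in lebesgue. x \<in> \<Omega> \<longrightarrow> g x = 0"
proof -
  have cbox: "AE x in lebesgue. x \<in> cbox a c \<longrightarrow> g x = 0" if ac: "cbox a c \<subseteq> \<Omega>" for a c
  proof -
    \<comment> \<open>As \<open>g\<close> is only locally integrable, it is cut off to a box whose
      closure lies in \<Omega>. Integrals of the cut-off function over boxes are integrals of
      \<open>g\<close> over smaller boxes.\<close>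
    let ?f = "\<lambda>x. indicator (box a c) x *\<^sub>R g x"
    have int: "integrable lebesgue ?f"
    proof -
      have "integrable lebesgue (\<lambda>x. indicator (box a c) x *\<^sub>R (indicator (cbox a c) x *\<^sub>R g x))"
        by (intro integrable_mult_indicator locally_integrable_onD[OF g _ ac]) auto
      also have "(\<lambda>x. indicator (box a c) x *\<^sub>R (indicator (cbox a c) x *\<^sub>R g x)) = ?f"
        using box_subset_cbox[of a c] by (fastforce simp: indicator_def)
      finally show ?thesis .
    qed
    have "(LINT x:box l u|lebesgue. ?f x) = 0" for l u
    proof -
      obtain l' u' where lu: "box l u \<inter> box a c = box l' u'"
        by (rule that, rule box_Int_box)
      have *: "(LINT x:box l u|lebesgue. ?f x) = (LINT x:box l' u'|lebesgue. g x)"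
        unfolding set_lebesgue_integral_def lu[symmetric] by (simp add: indicator_inter_arith)
      show ?thesis
      \<comment> \<open>For an empty intersection the corners are arbitrary and
        \<open>cbox l' u'\<close> need not lie in \<Omega>; for a nonempty one it is the closure of
        the intersection.\<close>
      proof (cases "box l' u' = {}")
        case False
        then have "cbox l' u' = closure (box l u \<inter> box a c)"
          by (simp add: lu)
        also have "\<dots> \<subseteq> cbox a c"
          using box_subset_cbox[of a c] by (intro closure_minimal) auto
        finally show ?thesis
          unfolding * using integral_box_eq_0[OF g _ 0] ac by blast
      next
        case True
        then show ?thesis unfolding * by (simp add: set_lebesgue_integral_def)
      qed
    qed
    moreover have "(LINT x|lebesgue. ?f x) = 0"
      using integral_box_eq_0[OF g ac 0] by (simp add: set_lebesgue_integral_def)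
    ultimately have "AE x in lebesgue. ?f x = 0"
      using int by (intro AE_eq_0_if_box_integrals_eq_0)
    moreover have "AE x in lebesgue. x \<notin> cbox a c - box a c"
      using negligible_frontier_interval by (intro AE_not_in) (simp add: negligible_iff_null_sets)
    ultimately show ?thesis
      by eventually_elim (auto simp: indicator_def)
  qed
  obtain D where D: "countable D" "D \<subseteq> Pow \<Omega>" "\<And>X. X \<in> D \<Longrightarrow> \<exists>a b. X = cbox a b" "\<Union>D = \<Omega>"
    using open_countable_Union_open_cbox[OF \<Omega>] by blast
  have "AE x in lebesgue. \<forall>X\<in>D. x \<in> X \<longrightarrow> g x = 0"
  proof (rule AE_ball_countable'[OF _ D(1)])
    fix X assume "X \<in> D"
    then obtain a c where "X = cbox a c" "cbox a c \<subseteq> \<Omega>" using D by blast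
    then show "AE x in lebesgue. x \<in> X \<longrightarrow> g x = 0" using cbox by simp
  qed
  then show ?thesis
    by eventually_elim (use D(4) in blast)
qed

section \<open>Weak gradients\<close>

lemma locally_integrable_on_continuous:
  fixes f :: "'a::euclidean_space \<Rightarrow> 'b::euclidean_space"
  assumes "continuous_on \<Omega> f"
  shows "locally_integrable_on f \<Omega>"
  unfolding locally_integrable_on_def
proof (intro allI impI)
  fix K assume K: "compact K \<and> K \<subseteq> \<Omega>"
  then have "integrable lborel (\<lambda>x. indicator K x *\<^sub>R f x)"
    using assms by (intro borel_integrable_compact) (auto intro: continuous_on_subset)
  then show "f absolutely_integrable_on K"
    unfolding set_integrable_def by (simp add: integrable_completion borel_measurable_integrable)
qed

text \<open>The bilinear \<open>h\<close> covers both sides of the identity that defines weak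
  gradients: a test function times a vector field, and a scalar function times the gradient of a
  test function.\<close>

lemma set_integrable_bilinear_compact_support:
  fixes f :: "'a::euclidean_space \<Rightarrow> 'b::euclidean_space" and g :: "'a \<Rightarrow> 'c::euclidean_space"
    and h :: "'b \<Rightarrow> 'c \<Rightarrow> 'd::euclidean_space"
  assumes h: "bilinear h" and K: "compact K" "K \<subseteq> \<Omega>"
    and f: "continuous_on UNIV f" "\<And>x. x \<notin> K \<Longrightarrow> f x = 0" and g: "locally_integrable_on g \<Omega>"
  shows "set_integrable lebesgue \<Omega> (\<lambda>x. h (f x) (g x))"
proof -
  have "(\<lambda>x. h (f x) (g x)) absolutely_integrable_on K"
  proof (rule absolutely_integrable_bounded_measurable_product[OF h])
    have "f \<in> borel_measurable lebesgue"
      using f(1) by (intro measurable_completion) (simp add: borel_measurable_continuous_onI)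
    then show "f \<in> borel_measurable (lebesgue_on K)"
      by (rule measurable_restrict_space1)
    show "K \<in> sets lebesgue"
      using K(1) by (simp add: lmeasurable_compact fmeasurableD)
    show "bounded (f ` K)"
      using f(1) K(1) by (intro compact_imp_bounded compact_continuous_image continuous_on_subset[OF f(1)]) auto
    show "g absolutely_integrable_on K"
      using g K by (simp add: locally_integrable_on_def)
  qed
  moreover have "(\<lambda>x. indicator K x *\<^sub>R h (f x) (g x)) = (\<lambda>x. indicator \<Omega> x *\<^sub>R h (f x) (g x))"
    using K f(2) bilinear_lzero[OF h] by (fastforce simp: indicator_def)
  ultimately show ?thesis
    by (simp add: set_integrable_def)
qed

lemma set_integrable_scaleR_test_function:
  assumes "test_function \<Omega> \<phi>"
  shows "locally_integrable_on (g :: 'a::euclidean_space \<Rightarrow> 'b::euclidean_space) \<Omega> \<Longrightarrow>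
      set_integrable lebesgue \<Omega> (\<lambda>x. \<phi> x *\<^sub>R g x)"
    and "locally_integrable_on u \<Omega> \<Longrightarrow> set_integrable lebesgue \<Omega> (\<lambda>x. u x *\<^sub>R grad \<phi> x)"
proof -
  obtain K where K: "compact K" "K \<subseteq> \<Omega>"
    and *: "\<And>x. x \<notin> K \<Longrightarrow> \<phi> x = 0" "\<And>x. x \<notin> K \<Longrightarrow> grad \<phi> x = 0"
      "continuous_on UNIV \<phi>" "continuous_on UNIV (grad \<phi>)"
    by (rule test_functionD[OF assms], rule that, assumption+)
  have "bilinear (\<lambda>(a::real) v::'b. a *\<^sub>R v)" "bilinear (\<lambda>v::'a. \<lambda>a::real. a *\<^sub>R v)"
    unfolding bilinear_def by (intro conjI allI linearI; simp add: scaleR_add_left scaleR_add_right)+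
  then show "locally_integrable_on g \<Omega> \<Longrightarrow> set_integrable lebesgue \<Omega> (\<lambda>x. \<phi> x *\<^sub>R g x)"
    and "locally_integrable_on u \<Omega> \<Longrightarrow> set_integrable lebesgue \<Omega> (\<lambda>x. u x *\<^sub>R grad \<phi> x)"
    using set_integrable_bilinear_compact_support[OF _ K *(3,1), of "\<lambda>a v. a *\<^sub>R v" g]
      set_integrable_bilinear_compact_support[OF _ K *(4,2), of "\<lambda>v a. a *\<^sub>R v" u]
    by auto
qed

lemma has_weak_grad_grad:
  fixes f :: "'a::euclidean_space \<Rightarrow> real"
  assumes \<Omega>: "open \<Omega>" and f: "Ck_on (Suc k) f \<Omega>"
  shows "has_weak_grad \<Omega> f (grad f)"
proof -
  have loc: "locally_integrable_on f \<Omega>" "locally_integrable_on (grad f) \<Omega>"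
    using f by (intro locally_integrable_on_continuous Ck_on_imp_continuous_on continuous_on_grad; blast)+
  have "(LINT x:\<Omega>|lebesgue. f x *\<^sub>R grad \<phi> x) = - (LINT x:\<Omega>|lebesgue. \<phi> x *\<^sub>R grad f x)"
    if \<phi>: "test_function \<Omega> \<phi>" for \<phi>
  proof (rule euclidean_eqI)
    fix b :: 'a assume b: "b \<in> Basis"
    note int = set_integrable_scaleR_test_function[OF \<phi>, unfolded set_integrable_def]
    have "(LINT x:\<Omega>|lebesgue. f x *\<^sub>R grad \<phi> x) \<bullet> b = (LINT x:\<Omega>|lebesgue. f x * (grad \<phi> x \<bullet> b))"
      unfolding set_lebesgue_integral_def using int(2)[OF loc(1)]
      by (simp add: mult.assoc flip: integral_inner_left)
    also have "\<dots> = - (LINT x:\<Omega>|lebesgue. \<phi> x * (grad f x \<bullet> b))"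
      using f by (intro integral_by_parts_test_function \<Omega> \<phi> has_derivative_grad continuous_intros
          continuous_on_grad) auto
    also have "\<dots> = (- (LINT x:\<Omega>|lebesgue. \<phi> x *\<^sub>R grad f x)) \<bullet> b"
      unfolding set_lebesgue_integral_def using int(1)[OF loc(2)]
      by (simp add: mult.assoc flip: integral_inner_left)
    finally show "(LINT x:\<Omega>|lebesgue. f x *\<^sub>R grad \<phi> x) \<bullet> b =
      (- (LINT x:\<Omega>|lebesgue. \<phi> x *\<^sub>R grad f x)) \<bullet> b" .
  qed
  with loc show ?thesis by (simp add: has_weak_grad_def)
qed

text \<open>Both fields have the same integrals against every test function, so the fundamental
  lemma applies to their difference.\<close>

lemma has_weak_grad_unique:
  assumes \<Omega>: "open \<Omega>" and g: "has_weak_grad \<Omega> u g" and h: "has_weak_grad \<Omega> u h"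
  shows "AE x in lebesgue. x \<in> \<Omega> \<longrightarrow> g x = h x"
proof -
  have loc: "locally_integrable_on g \<Omega>" "locally_integrable_on h \<Omega>"
    using g h by (auto simp: has_weak_grad_def)
  have "AE x in lebesgue. x \<in> \<Omega> \<longrightarrow> g x - h x = 0"
  proof (rule fundamental_lemma_calculus_of_variations[OF \<Omega>])
    show "locally_integrable_on (\<lambda>x. g x - h x) \<Omega>"
      using loc by (simp add: locally_integrable_on_def set_integral_diff)
    fix \<phi> assume \<phi>: "test_function \<Omega> \<phi>"
    then have "(LINT x:\<Omega>|lebesgue. \<phi> x *\<^sub>R g x) = (LINT x:\<Omega>|lebesgue. \<phi> x *\<^sub>R h x)"
      using g h by (simp add: has_weak_grad_def)
    then show "(LINT x:\<Omega>|lebesgue. \<phi> x *\<^sub>R (g x - h x)) = 0"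
      using set_integral_diff(2)[OF set_integrable_scaleR_test_function(1)[OF \<phi> loc(1)]
          set_integrable_scaleR_test_function(1)[OF \<phi> loc(2)]]
      by (simp add: scaleR_diff_right)
  qed
  then show ?thesis by simp
qed

lemma has_weak_grad_scaleR:
  assumes "has_weak_grad \<Omega> u g"
  shows "has_weak_grad \<Omega> (\<lambda>x. c * u x) (\<lambda>x. c *\<^sub>R g x)"
proof -
  have "(LINT x:\<Omega>|lebesgue. (c * u x) *\<^sub>R grad \<phi> x) = - (LINT x:\<Omega>|lebesgue. \<phi> x *\<^sub>R c *\<^sub>R g x)"
    if "test_function \<Omega> \<phi>" for \<phi>
  proof -
    have "(LINT x:\<Omega>|lebesgue. c *\<^sub>R (u x *\<^sub>R grad \<phi> x)) = - (LINT x:\<Omega>|lebesgue. c *\<^sub>R (\<phi> x *\<^sub>R g x))"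
      using assms that by (simp only: set_integral_scaleR_right has_weak_grad_def scaleR_minus_right)
    then show ?thesis by (simp add: mult.commute)
  qed
  then show ?thesis
    using assms by (simp add: has_weak_grad_def locally_integrable_on_def)
qed

lemma has_weak_grad_add:
  assumes g: "has_weak_grad \<Omega> u g" and h: "has_weak_grad \<Omega> v h"
  shows "has_weak_grad \<Omega> (\<lambda>x. u x + v x) (\<lambda>x. g x + h x)"
proof -
  have loc: "locally_integrable_on u \<Omega>" "locally_integrable_on v \<Omega>"
    "locally_integrable_on g \<Omega>" "locally_integrable_on h \<Omega>"
    using g h by (auto simp: has_weak_grad_def)
  have "(LINT x:\<Omega>|lebesgue. (u x + v x) *\<^sub>R grad \<phi> x) = - (LINT x:\<Omega>|lebesgue. \<phi> x *\<^sub>R (g x + h x))"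
    if \<phi>: "test_function \<Omega> \<phi>" for \<phi>
  proof -
    note int = set_integrable_scaleR_test_function[OF \<phi>]
    show ?thesis
      using set_integral_add(2)[OF int(2)[OF loc(1)] int(2)[OF loc(2)]]
        set_integral_add(2)[OF int(1)[OF loc(3)] int(1)[OF loc(4)]] g h \<phi>
      by (simp add: has_weak_grad_def scaleR_add_left scaleR_add_right)
  qed
  then show ?thesis
    using loc by (simp add: has_weak_grad_def locally_integrable_on_def set_integral_add)
qed

lemma weak_grad_AE_eq:
  assumes "open \<Omega>" "has_weak_grad \<Omega> u g"
  shows "AE x in lebesgue. x \<in> \<Omega> \<longrightarrow> weak_grad \<Omega> u x = g x"
  unfolding weak_grad_def
  using has_weak_grad_unique[OF assms(1) someI[of "has_weak_grad \<Omega> u", OF assms(2)] assms(2)] .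

lemma has_weak_grad_weak_grad:
  "weakly_differentiable \<Omega> u \<Longrightarrow> has_weak_grad \<Omega> u (weak_grad \<Omega> u)"
  unfolding weakly_differentiable_def weak_grad_def by (rule someI_ex[of "has_weak_grad \<Omega> u"])

section \<open>Symmetry of second derivatives\<close>

text \<open>The mean value theorem is applied in direction \<open>b\<close> to the increment over
  \<open>c\<close>, and once more in direction \<open>c\<close> to the derivative obtained. Only the
  mixed derivative in this order is used.\<close>

lemma second_difference_mvt:
  fixes f :: "'a::real_normed_vector \<Rightarrow> real"
  assumes f: "\<And>y. y \<in> ball x r \<Longrightarrow> (f has_derivative f' y) (at y)"
    and g: "\<And>y. y \<in> ball x r \<Longrightarrow> ((\<lambda>y. f' y b) has_derivative g y) (at y)"
    and s: "s > 0" "s * (norm b + norm c) < r"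
  obtains y where "dist x y \<le> s * (norm b + norm c)"
    "f (x + s *\<^sub>R c + s *\<^sub>R b) - f (x + s *\<^sub>R c) - f (x + s *\<^sub>R b) + f x = s * s * g y c"
proof -
  have near: "dist x (x + \<sigma> *\<^sub>R c + \<tau> *\<^sub>R b) \<le> s * (norm b + norm c)"
    if "0 \<le> \<sigma>" "\<sigma> \<le> s" "0 \<le> \<tau>" "\<tau> \<le> s" for \<sigma> \<tau>
  proof -
    have "dist x (x + \<sigma> *\<^sub>R c + \<tau> *\<^sub>R b) = norm (\<sigma> *\<^sub>R c + \<tau> *\<^sub>R b)"
      by (metis add.assoc add_diff_cancel_left' dist_commute dist_norm)
    also have "\<dots> \<le> \<sigma> * norm c + \<tau> * norm b"
      using that norm_triangle_ineq[of "\<sigma> *\<^sub>R c" "\<tau> *\<^sub>R b"] by simp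
    also have "\<dots> \<le> s * norm c + s * norm b"
      using that by (intro add_mono mult_right_mono) auto
    finally show ?thesis by (simp add: algebra_simps)
  qed
  then have ball: "x + \<sigma> *\<^sub>R c + \<tau> *\<^sub>R b \<in> ball x r"
    if "0 \<le> \<sigma>" "\<sigma> \<le> s" "0 \<le> \<tau>" "\<tau> \<le> s" for \<sigma> \<tau>
    using that s(2) by (meson le_less_trans mem_ball)
  \<comment> \<open>The vacuous summand \<open>0 *\<^sub>R c\<close> gives both terms the shape that
    \<open>ball\<close> covers.\<close>
  let ?P = "\<lambda>\<tau>. f (x + s *\<^sub>R c + \<tau> *\<^sub>R b) - f (x + 0 *\<^sub>R c + \<tau> *\<^sub>R b)"
  have "(?P has_field_derivative f' (x + s *\<^sub>R c + \<tau> *\<^sub>R b) b - f' (x + 0 *\<^sub>R c + \<tau> *\<^sub>R b) b) (at \<tau>)"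
    if "0 \<le> \<tau>" "\<tau> \<le> s" for \<tau>
    using that s(1) by (intro DERIV_diff has_field_derivative_along_line f ball) auto
  from MVT2[OF s(1), of ?P, OF this] obtain \<tau> where \<tau>: "0 < \<tau>" "\<tau> < s"
    "?P s - ?P 0 = s * (f' (x + s *\<^sub>R c + \<tau> *\<^sub>R b) b - f' (x + 0 *\<^sub>R c + \<tau> *\<^sub>R b) b)"
    by auto
  let ?Q = "\<lambda>\<sigma>. f' (x + \<tau> *\<^sub>R b + \<sigma> *\<^sub>R c) b"
  have swap: "x + \<tau> *\<^sub>R b + \<sigma> *\<^sub>R c = x + \<sigma> *\<^sub>R c + \<tau> *\<^sub>R b" for \<sigma>
    by (simp add: algebra_simps)
  have "(?Q has_field_derivative g (x + \<tau> *\<^sub>R b + \<sigma> *\<^sub>R c) c) (at \<sigma>)" if "0 \<le> \<sigma>" "\<sigma> \<le> s" for \<sigma>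
    using ball[OF that, of \<tau>] \<tau> g
    by (intro has_field_derivative_along_line[of "\<lambda>y. f' y b"]) (simp add: swap)
  from MVT2[OF s(1), of ?Q, OF this] obtain \<sigma> where \<sigma>: "0 < \<sigma>" "\<sigma> < s"
    "?Q s - ?Q 0 = s * g (x + \<tau> *\<^sub>R b + \<sigma> *\<^sub>R c) c"
    by auto
  have "?P s - ?P 0 = s * (?Q s - ?Q 0)"
    using \<tau>(3) by (simp add: swap)
  also have "\<dots> = s * s * g (x + \<sigma> *\<^sub>R c + \<tau> *\<^sub>R b) c"
    using \<sigma>(3) swap[of \<sigma>] by simp
  finally show ?thesis
    using near[of \<sigma> \<tau>] \<sigma> \<tau> by (intro that[of "x + \<sigma> *\<^sub>R c + \<tau> *\<^sub>R b"]) auto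
qed

text \<open>The second difference is unchanged when \<open>b\<close> and \<open>c\<close> are
  exchanged, so it equals \<open>s * s * g y c\<close> and also \<open>s * s * h z b\<close> at two
  points near \<open>x\<close>. Continuity brings both values back to \<open>x\<close>.\<close>

lemma second_derivative_symmetric:
  fixes f :: "'a::real_normed_vector \<Rightarrow> real"
  assumes \<Omega>: "open \<Omega>" "x \<in> \<Omega>"
    and f: "\<And>y. y \<in> \<Omega> \<Longrightarrow> (f has_derivative f' y) (at y)"
    and g: "\<And>y. y \<in> \<Omega> \<Longrightarrow> ((\<lambda>y. f' y b) has_derivative g y) (at y)"
    and h: "\<And>y. y \<in> \<Omega> \<Longrightarrow> ((\<lambda>y. f' y c) has_derivative h y) (at y)"
    and cont: "continuous_on \<Omega> (\<lambda>y. g y c)" "continuous_on \<Omega> (\<lambda>y. h y b)"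
  shows "g x c = h x b"
proof -
  have "\<bar>g x c - h x b\<bar> \<le> 0 + e" if "e > 0" for e
  proof -
    obtain r where r: "r > 0" "ball x r \<subseteq> \<Omega>"
      using \<Omega> open_contains_ball by blast
    have "isCont (\<lambda>y. g y c) x" "isCont (\<lambda>y. h y b) x"
      using cont \<Omega> by (auto simp: continuous_on_eq_continuous_at)
    then obtain d1 d2 where d: "d1 > 0" "\<And>y. dist y x < d1 \<Longrightarrow> dist (g y c) (g x c) < e / 2"
      "d2 > 0" "\<And>y. dist y x < d2 \<Longrightarrow> dist (h y b) (h x b) < e / 2"
      using \<open>e > 0\<close> unfolding continuous_at_eps_delta by (metis half_gt_zero)
    define m where "m = min r (min d1 d2)"
    \<comment> \<open>This puts all corners of the parallelogram within distance \<open>m\<close> of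
      \<open>x\<close>; the summand 1 avoids division by zero for \<open>b = c = 0\<close>.\<close>
    define s where "s = m / (norm b + norm c + 1)"
    have m: "m > 0" "m \<le> r" "m \<le> d1" "m \<le> d2" using r d by (auto simp: m_def)
    have N: "norm b + norm c + 1 > 0" using norm_ge_zero[of b] norm_ge_zero[of c] by linarith
    have s: "s > 0" using m N by (simp add: s_def)
    have sm: "s * (norm b + norm c) < m"
      using m(1) N by (simp add: s_def field_simps)
    obtain y where y: "dist x y \<le> s * (norm b + norm c)"
      "f (x + s *\<^sub>R c + s *\<^sub>R b) - f (x + s *\<^sub>R c) - f (x + s *\<^sub>R b) + f x = s * s * g y c"
      by (rule second_difference_mvt[of x r f f' b g s c]) (use f g r s sm m in auto)
    obtain z where z: "dist x z \<le> s * (norm c + norm b)"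
      "f (x + s *\<^sub>R b + s *\<^sub>R c) - f (x + s *\<^sub>R b) - f (x + s *\<^sub>R c) + f x = s * s * h z b"
      by (rule second_difference_mvt[of x r f f' c h s b]) (use f h r s sm m in \<open>auto simp: add.commute\<close>)
    have "s * s * g y c = s * s * h z b"
      using y(2) z(2) by (simp add: algebra_simps)
    then have "g y c = h z b" using s by simp
    moreover have "dist y x < d1" "dist z x < d2"
      using y(1) z(1) sm m by (simp_all add: dist_commute add.commute)
    then have "dist (g y c) (g x c) < e / 2" "dist (h z b) (h x b) < e / 2"
      using d(2)[of y] d(4)[of z] by blast+
    ultimately show ?thesis
      using dist_triangle3[of "g x c" "h x b" "g y c"] by (simp add: dist_real_def)
  qed
  then have "\<bar>g x c - h x b\<bar> \<le> 0" by (rule field_le_epsilon)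
  then show ?thesis by simp
qed

text \<open>\<open>H x\<close> is the Hessian, assembled from the derivatives of the partial
  derivatives. \<open>Ck_on\<close> gives its continuity on basis vectors only; linearity extends it
  to all directions.\<close>

lemma Ck_on_2_grad:
  fixes u :: "'a::euclidean_space \<Rightarrow> real"
  assumes \<Omega>: "open \<Omega>" and u: "Ck_on 2 u \<Omega>"
  obtains H where "\<And>x. x \<in> \<Omega> \<Longrightarrow> (grad u has_derivative H x) (at x)"
    "\<And>h. continuous_on \<Omega> (\<lambda>x. H x h)" "\<And>x v w. x \<in> \<Omega> \<Longrightarrow> H x v \<bullet> w = v \<bullet> H x w"
proof -
  define D where "D b x = frechet_derivative u (at x) b" for b x
  define H where "H x h = (\<Sum>b\<in>Basis. frechet_derivative (D b) (at x) h *\<^sub>R b)" for x h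
  have u': "\<And>x. x \<in> \<Omega> \<Longrightarrow> u differentiable (at x)"
    and D': "\<And>x b. x \<in> \<Omega> \<Longrightarrow> b \<in> Basis \<Longrightarrow> D b differentiable (at x)"
    and D'': "\<And>b c. c \<in> Basis \<Longrightarrow> b \<in> Basis \<Longrightarrow>
      continuous_on \<Omega> (\<lambda>x. frechet_derivative (D b) (at x) c)"
    using u by (auto simp: numeral_2_eq_2 D_def[abs_def])
  have HD: "H x h \<bullet> b = frechet_derivative (D b) (at x) h" if "b \<in> Basis" for x h b
    using that by (simp add: H_def)
  have "((\<lambda>y. grad u y \<bullet> b) has_derivative frechet_derivative (D b) (at x)) (at x)"
    if x: "x \<in> \<Omega>" and b: "b \<in> Basis" for x b
  proof (rule has_derivative_transform_within_open[OF _ \<Omega> x])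
    show "(D b has_derivative frechet_derivative (D b) (at x)) (at x)"
      using D'[OF x b] frechet_derivative_works by blast
  qed (simp add: D_def frechet_derivative_eq_grad u')
  then have H': "(grad u has_derivative H x) (at x)" if "x \<in> \<Omega>" for x
    using that by (subst has_derivative_componentwise_within) (simp add: HD)
  have contB: "continuous_on \<Omega> (\<lambda>x. H x c)" if "c \<in> Basis" for c
    unfolding H_def using that D'' by (intro continuous_intros)
  have cont: "continuous_on \<Omega> (\<lambda>x. H x h)" for h
  proof -
    have "continuous_on \<Omega> (\<lambda>x. \<Sum>c\<in>Basis. (h \<bullet> c) *\<^sub>R H x c)"
      by (intro continuous_intros contB)
    then show ?thesis
    proof (rule continuous_on_eq)
      fix x assume "x \<in> \<Omega>"
      then have lin: "linear (H x)" using H' has_derivative_linear by blast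
      have "(\<Sum>c\<in>Basis. (h \<bullet> c) *\<^sub>R H x c) = H x (\<Sum>c\<in>Basis. (h \<bullet> c) *\<^sub>R c)"
        by (simp only: linear_sum[OF lin] linear_scale[OF lin])
      then show "(\<Sum>c\<in>Basis. (h \<bullet> c) *\<^sub>R H x c) = H x h"
        by (simp only: euclidean_representation)
    qed
  qed
  have "H x v \<bullet> w = v \<bullet> H x w" if x: "x \<in> \<Omega>" for x v w
  proof -
    have "H x v \<bullet> w = H x w \<bullet> v"
      by (rule second_derivative_symmetric[OF \<Omega> x has_derivative_grad[OF u'],
            of w "\<lambda>x h. H x h \<bullet> w" v "\<lambda>x h. H x h \<bullet> v"])
        (auto intro!: has_derivative_inner_left H' continuous_intros cont)
    then show ?thesis by (simp add: inner_commute)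
  qed
  with H' cont that show ?thesis by blast
qed

section \<open>Measure of the set where a field of rank at least two is small\<close>

text \<open>Otherwise A = H - J has its range in a line spanned by some y. A vector w orthogonal to
  y and to the image of y under the adjoint is killed by A and by its adjoint, hence by the skew
  part J. In dimension above 2 such a w can be chosen nonzero, against injectivity of J.\<close>

lemma exists_plane_injective_symmetric_minus_skew:
  fixes H J :: "'a::euclidean_space \<Rightarrow> 'a"
  assumes dim: "DIM('a) > 2" and lin: "linear H" "linear J"
    and H: "\<And>v w. H v \<bullet> w = v \<bullet> H w" and J: "\<And>v w. J v \<bullet> w = - (v \<bullet> J w)"
    and J0: "\<And>v. J v = 0 \<Longrightarrow> v = 0"
  shows "\<exists>v w. \<forall>a b. H (a *\<^sub>R v + b *\<^sub>R w) - J (a *\<^sub>R v + b *\<^sub>R w) = 0 \<longrightarrow> a = 0 \<and> b = 0"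
proof (rule ccontr)
  define A where "A x = H x - J x" for x
  have linA: "linear A"
    unfolding A_def using lin by (rule linear_compose_sub)
  assume "\<not> ?thesis"
  then have nex: "\<exists>a b. A (a *\<^sub>R v + b *\<^sub>R w) = 0 \<and> \<not> (a = 0 \<and> b = 0)" for v w
    by (auto simp: A_def)
  \<comment> \<open>If some \<open>A v\<close> is nonzero, it serves as \<open>y\<close>; if A
    vanishes, any \<open>y\<close> does. The coefficient is that of the orthogonal projection onto
    \<open>y\<close>.\<close>
  have "\<exists>y. \<forall>w. A w = (A w \<bullet> y / (y \<bullet> y)) *\<^sub>R y"
  proof (cases "\<exists>v. A v \<noteq> 0")
    case True
    then obtain v where v: "A v \<noteq> 0" by blast
    have "A w = (A w \<bullet> A v / (A v \<bullet> A v)) *\<^sub>R A v" for w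
    proof -
      obtain a b where ab: "A (a *\<^sub>R v + b *\<^sub>R w) = 0" "\<not> (a = 0 \<and> b = 0)"
        using nex by blast
      then have eq: "a *\<^sub>R A v + b *\<^sub>R A w = 0"
        by (simp add: linear_add[OF linA] linear_scale[OF linA])
      then have "b \<noteq> 0" using v ab(2) by auto
      have "b *\<^sub>R A w = - (a *\<^sub>R A v)"
        using eq by (simp add: eq_neg_iff_add_eq_0 add.commute)
      then have "(1 / b) *\<^sub>R (b *\<^sub>R A w) = (- a / b) *\<^sub>R A v"
        by simp
      then have "A w = (- a / b) *\<^sub>R A v" using \<open>b \<noteq> 0\<close> by simp
      then obtain t where "A w = t *\<^sub>R A v" by blast
      then show ?thesis using v by simp
    qed
    then show ?thesis by blast
  qed auto
  then obtain y where y: "A w = (A w \<bullet> y / (y \<bullet> y)) *\<^sub>R y" for w by blast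
  have "dim {adjoint A y, y} \<le> card {adjoint A y, y}"
    by (intro dim_le_card') auto
  also have "\<dots> < DIM('a)"
    using dim card_insert_le_m1[of 2 "{y}" "adjoint A y"] by simp
  finally obtain w where w: "w \<noteq> 0" "\<And>z. z \<in> span {adjoint A y, y} \<Longrightarrow> orthogonal w z"
    using orthogonal_to_subspace_exists by blast
  have "w \<bullet> adjoint A y = 0" "w \<bullet> y = 0"
    using w(2) by (auto simp: orthogonal_def span_base)
  then have "A w = 0" using y[of w] by (simp add: adjoint_works[OF linA])
  have Az: "A z \<bullet> w = 0" for z
    by (subst y[of z]) (use \<open>w \<bullet> y = 0\<close> in \<open>simp add: inner_commute\<close>)
  have "J w \<bullet> z = 0" for z
  proof -
    have "0 = A w \<bullet> z - A z \<bullet> w" using \<open>A w = 0\<close> Az by simp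
    also have "\<dots> = (H w \<bullet> z - w \<bullet> H z) - (J w \<bullet> z - w \<bullet> J z)"
      by (simp add: A_def inner_diff_left inner_diff_right inner_commute)
    also have "\<dots> = - 2 * (J w \<bullet> z)"
      using H[of w z] J[of w z] by simp
    finally show ?thesis by simp
  qed
  then have "J w = 0" by (metis inner_eq_zero_iff)
  with w(1) J0 show False by blast
qed

text \<open>Strict differentiability: the mean value inequality for F minus its linear part at
  \<open>p\<close>. On a small ball each basis vector contributes at most \<open>d / DIM('a)\<close>
  to the operator norm of the derivative.\<close>

lemma strict_derivative_bound:
  fixes F :: "'a::euclidean_space \<Rightarrow> 'b::euclidean_space"
  assumes \<Omega>: "open \<Omega>" "p \<in> \<Omega>" and F: "\<And>x. x \<in> \<Omega> \<Longrightarrow> (F has_derivative F' x) (at x)"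
    and cont: "\<And>h. continuous_on \<Omega> (\<lambda>x. F' x h)" and d: "d > 0"
  obtains r where "r > 0" "ball p r \<subseteq> \<Omega>"
    "\<And>x y. x \<in> ball p r \<Longrightarrow> y \<in> ball p r \<Longrightarrow> norm (F x - F y - F' p (x - y)) \<le> d * norm (x - y)"
proof -
  have d': "d / DIM('a) > 0" using d by simp
  have "\<forall>\<^sub>F x in at p. \<forall>b\<in>Basis. dist (F' x b) (F' p b) < d / DIM('a)"
  proof (rule eventually_ball_finite[OF finite_Basis], rule ballI)
    fix b :: 'a
    have "isCont (\<lambda>x. F' x b) p"
      using cont[of b] \<Omega> by (simp add: continuous_on_eq_continuous_at)
    then show "\<forall>\<^sub>F x in at p. dist (F' x b) (F' p b) < d / DIM('a)"
      unfolding isCont_def using d' by (rule tendstoD)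
  qed
  moreover have "\<forall>\<^sub>F x in at p. x \<in> \<Omega>"
    using \<Omega> by (rule eventually_at_in_open')
  ultimately have "\<forall>\<^sub>F x in at p. x \<in> \<Omega> \<and> (\<forall>b\<in>Basis. dist (F' x b) (F' p b) < d / DIM('a))"
    by eventually_elim blast
  then obtain r where r: "r > 0" and
    *: "\<And>x. x \<noteq> p \<Longrightarrow> dist x p < r \<Longrightarrow> x \<in> \<Omega> \<and> (\<forall>b\<in>Basis. dist (F' x b) (F' p b) < d / DIM('a))"
    unfolding eventually_at by blast
  have near: "x \<in> \<Omega> \<and> (\<forall>b\<in>Basis. norm (F' x b - F' p b) \<le> d / DIM('a))" if "x \<in> ball p r" for x
  proof (cases "x = p")
    case True
    then show ?thesis using \<Omega>(2) d' by simp
  next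
    case False
    then show ?thesis
      using *[OF False] that by (auto simp: dist_commute dist_norm norm_minus_commute intro: less_imp_le)
  qed
  have linp: "bounded_linear (F' p)"
    using F[OF \<Omega>(2)] by (rule has_derivative_bounded_linear)
  have "norm (F x - F y - F' p (x - y)) \<le> d * norm (x - y)"
    if xy: "x \<in> ball p r" "y \<in> ball p r" for x y
  proof -
    have "norm ((F x - F' p x) - (F y - F' p y)) \<le> d * norm (x - y)"
    proof (rule differentiable_bound[OF convex_ball _ _ xy])
      fix z assume z: "z \<in> ball p r"
      have der: "((\<lambda>x. F x - F' p x) has_derivative (\<lambda>h. F' z h - F' p h)) (at z)"
        using conjunct1[OF near[OF z]] by (intro has_derivative_diff F bounded_linear_imp_has_derivative[OF linp])
      then show "((\<lambda>x. F x - F' p x) has_derivative (\<lambda>h. F' z h - F' p h)) (at z within ball p r)"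
        by (rule has_derivative_at_withinI)
      have "onorm (\<lambda>h. F' z h - F' p h) \<le> (\<Sum>b\<in>Basis. norm (F' z b - F' p b))"
        using der by (intro onorm_componentwise has_derivative_bounded_linear)
      also have "\<dots> \<le> (\<Sum>b\<in>(Basis::'a set). d / DIM('a))"
        using near[OF z] by (intro sum_mono) blast
      finally show "onorm (\<lambda>h. F' z h - F' p h) \<le> d" by simp
    qed
    then show ?thesis
      by (simp add: linear_diff[OF bounded_linear.linear[OF linp]] algebra_simps)
  qed
  moreover have "ball p r \<subseteq> \<Omega>" using near by blast
  ultimately show ?thesis using that r by blast
qed

text \<open>If \<open>F'\<close> is injective on a plane at \<open>p\<close>, then about \<open>\<epsilon>\<^sup>-\<^sup>2\<close> translates of the sublevel set along a
  lattice of mesh comparable to \<open>\<epsilon>\<close> in this plane are disjoint, and all of them lie in a fixed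
  ball.\<close>

lemma measure_small_values_le:
  fixes F :: "'a::euclidean_space \<Rightarrow> 'b::euclidean_space"
  assumes \<Omega>: "open \<Omega>" "p \<in> \<Omega>" and F: "\<And>x. x \<in> \<Omega> \<Longrightarrow> (F has_derivative F' x) (at x)"
    and cont: "\<And>h. continuous_on \<Omega> (\<lambda>x. F' x h)"
    and inj: "\<And>a b. F' p (a *\<^sub>R v + b *\<^sub>R w) = 0 \<Longrightarrow> a = 0 \<and> b = 0"
  obtains r C where "r > 0" "ball p r \<subseteq> \<Omega>"
    "\<forall>e>0. measure lebesgue {x \<in> ball p r. norm (F x) < e} \<le> C * e\<^sup>2"
proof -
  let ?T = "\<lambda>ab. fst ab *\<^sub>R v + snd ab *\<^sub>R w :: 'a"
  have linp: "linear (F' p)"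
    using F[OF \<Omega>(2)] by (rule has_derivative_linear)
  have linT: "linear ?T"
    by (auto intro!: linearI simp: algebra_simps)
  have "linear (F' p \<circ> ?T)"
    using linT linp by (rule linear_compose)
  moreover have "inj (F' p \<circ> ?T)"
    using \<open>linear (F' p \<circ> ?T)\<close> inj by (auto simp: linear_inj_iff_eq_0 zero_prod_def)
  ultimately obtain c where c0: "c > 0" "\<And>ab. c * norm ab \<le> norm ((F' p \<circ> ?T) ab)"
    using linear_inj_bounded_below_pos[of "F' p \<circ> ?T"] by blast
  have c: "c > 0" "\<And>ab. c * norm ab \<le> norm (F' p (?T ab))"
    using c0 unfolding comp_apply by blast+
  define L where "L = norm v + norm w + 1"
  have L: "L > 0" using norm_ge_zero[of v] norm_ge_zero[of w] unfolding L_def by linarith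
  have T_le: "norm (?T ab) \<le> L * norm ab" for ab
  proof -
    have "norm (?T ab) \<le> \<bar>fst ab\<bar> * norm v + \<bar>snd ab\<bar> * norm w"
      using norm_triangle_ineq[of "fst ab *\<^sub>R v" "snd ab *\<^sub>R w"] by simp
    also have "\<dots> \<le> norm ab * norm v + norm ab * norm w"
      using norm_fst_le[of "fst ab" "snd ab"] norm_snd_le[of "snd ab" "fst ab"]
      by (intro add_mono mult_right_mono norm_ge_zero) (simp_all only: prod.collapse real_norm_def)
    also have "\<dots> \<le> L * norm ab" by (simp add: L_def algebra_simps)
    finally show ?thesis .
  qed
  \<comment> \<open>With this tolerance the nonlinear error along the plane is at most
    \<open>c / 2 * norm ab\<close>, which leaves half of the expansion rate \<open>c\<close> of the
    linear part.\<close>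
  have "c / (2 * L) > 0" using c L by simp
  from strict_derivative_bound[OF \<Omega> F cont this] obtain r where r: "r > 0" "ball p r \<subseteq> \<Omega>"
    and strict: "\<And>x y. x \<in> ball p r \<Longrightarrow> y \<in> ball p r \<Longrightarrow>
      norm (F x - F y - F' p (x - y)) \<le> c / (2 * L) * norm (x - y)"
    by blast
  have expand: "c / 2 * norm ab \<le> norm (F x - F y)"
    if xy: "x \<in> ball p r" "y \<in> ball p r" "x - y = ?T ab" for x y ab
  proof -
    have "c * norm ab \<le> norm (F' p (?T ab))" by (rule c)
    also have "\<dots> \<le> norm (F x - F y) + norm (F x - F y - F' p (x - y))"
      unfolding xy(3)[symmetric]
      by (metis norm_minus_commute norm_triangle_sub)
    also have "norm (F x - F y - F' p (x - y)) \<le> c / (2 * L) * (L * norm ab)"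
      using strict[OF xy(1,2)] T_le[of ab] \<open>c / (2 * L) > 0\<close> unfolding xy(3)
      by (meson less_imp_le mult_left_mono order_trans)
    also have "\<dots> = c / 2 * norm ab" using L by simp
    finally show ?thesis by linarith
  qed
  define V where "V = measure lebesgue (ball p (r + 2 * L))"
  have "measure lebesgue {x \<in> ball p r. norm (F x) < e} \<le> 16 * V / c\<^sup>2 * e\<^sup>2" if e: "e > 0" for e
  proof -
    define E where "E = {x \<in> ball p r. norm (F x) < e}"
    \<comment> \<open>Values of \<open>F\<close> at two points of \<open>E\<close> differ by less
      than \<open>2 * e\<close>, so by \<open>expand\<close> their plane coordinates differ by less
      than \<open>4 * e / c\<close> if the difference lies in the plane.\<close>
    define h where "h = 4 * e / c"
    \<comment> \<open>Rounding up yields at least \<open>1 / h\<close> translates per direction,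
      while indices strictly below \<open>M\<close> keep each coordinate of a shift at most
      1.\<close>
    define M where "M = nat \<lceil>1 / h\<rceil>"
    have h: "h > 0" using e c by (simp add: h_def)
    have M: "1 / h \<le> M" "\<And>i. i < M \<Longrightarrow> real i * h \<le> 1"
    proof -
      show "1 / h \<le> M" by (simp add: M_def real_nat_ceiling_ge)
      fix i assume "i < M"
      then have "real i < 1 / h" unfolding M_def by linarith
      then show "real i * h \<le> 1" using h by (simp add: field_simps)
    qed
    define t where "t ij = ?T (h * real (fst ij), h * real (snd ij))" for ij :: "nat \<times> nat"
    let ?I = "{..<M} \<times> {..<M}"
    have "continuous_on (ball p r) (\<lambda>x. norm (F x))"
      using F r(2) by (intro continuous_on_norm continuous_at_imp_continuous_on ballI)
        (meson has_derivative_continuous subsetD)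
    then have "open (ball p r \<inter> (\<lambda>x. norm (F x)) -` {..<e})"
      by (intro continuous_open_preimage) auto
    moreover have "ball p r \<inter> (\<lambda>x. norm (F x)) -` {..<e} = E" by (auto simp: E_def)
    ultimately have "open E" by simp
    moreover have "bounded E" by (rule bounded_subset[OF bounded_ball[of p r]]) (auto simp: E_def)
    ultimately have E: "E \<in> lmeasurable" by (rule lmeasurable_open[rotated])
    \<comment> \<open>\<open>F\<close> is never evaluated on the translates, which may leave
      \<Omega>. A common point yields two points of \<open>E\<close> whose difference is a nonzero
      lattice vector, too long for \<open>expand\<close>.\<close>
    have disj: "disjoint_family_on (\<lambda>ij. (+) (t ij) ` E) ?I"
    proof (unfold disjoint_family_on_def, intro ballI impI)
      fix ij kl :: "nat \<times> nat" assume ne: "ij \<noteq> kl"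
      show "(+) (t ij) ` E \<inter> (+) (t kl) ` E = {}"
      proof (rule ccontr)
        assume "\<not> ?thesis"
        then obtain x y where xy: "x \<in> E" "y \<in> E" "t ij + x = t kl + y" by auto
        let ?ab = "(h * real (fst kl) - h * real (fst ij), h * real (snd kl) - h * real (snd ij))"
        have "x - y = t kl - t ij" using xy(3) by (simp add: algebra_simps)
        then have "x - y = ?T ?ab" by (simp add: t_def algebra_simps)
        then have "c / 2 * norm ?ab \<le> norm (F x - F y)"
          using xy by (intro expand) (auto simp: E_def)
        also have "\<dots> < 2 * e"
          using norm_triangle_ineq4[of "F x" "F y"] xy by (auto simp: E_def)
        finally have "norm ?ab < h" using c by (simp add: h_def field_simps)
        moreover have "h \<le> norm ?ab"
        proof -
          have "h \<le> \<bar>h * real m - h * real n\<bar>" if "m \<noteq> n" for m n :: nat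
          proof -
            have "1 \<le> \<bar>real m - real n\<bar>" using that by linarith
            then show ?thesis using h by (simp add: abs_mult flip: right_diff_distrib)
          qed
          moreover have "fst kl \<noteq> fst ij \<or> snd kl \<noteq> snd ij" using ne by (auto simp: prod_eq_iff)
          ultimately show ?thesis
            using norm_fst_le[of "fst ?ab" "snd ?ab"] norm_snd_le[of "snd ?ab" "fst ?ab"]
            unfolding prod.collapse real_norm_def fst_conv snd_conv by (blast intro: order_trans)
        qed
        ultimately show False by simp
      qed
    qed
    have img: "(+) (t ij) ` E \<in> lmeasurable" for ij
      using E by (rule measurable_translation)
    have "measure lebesgue (\<Union>ij\<in>?I. (+) (t ij) ` E) = (\<Sum>ij\<in>?I. measure lebesgue ((+) (t ij) ` E))"
    proof (rule measure_finite_Union[OF _ _ disj])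
      show "emeasure lebesgue ((+) (t ij) ` E) \<noteq> \<infinity>" for ij
        unfolding infinity_ennreal_def by (rule fmeasurableD2[OF img])
    qed (use img in \<open>auto dest: fmeasurableD\<close>)
    also have "\<dots> = real M * real M * measure lebesgue E"
      by (simp add: measure_translation)
    finally have "real M * real M * measure lebesgue E = measure lebesgue (\<Union>ij\<in>?I. (+) (t ij) ` E)" ..
    also have "\<dots> \<le> V"
      unfolding V_def
    proof (rule measure_mono_fmeasurable)
      show "(\<Union>ij\<in>?I. (+) (t ij) ` E) \<in> sets lebesgue"
        using img by (intro sets.finite_UN) (auto dest: fmeasurableD)
      show "(\<Union>ij\<in>?I. (+) (t ij) ` E) \<subseteq> ball p (r + 2 * L)"
      proof (rule UN_least, rule image_subsetI)
        fix ij x assume ij: "ij \<in> ?I" and x: "x \<in> E"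
        have "norm (h * real (fst ij), h * real (snd ij)) \<le> norm (h * real (fst ij)) + norm (h * real (snd ij))"
          by (rule norm_Pair_le)
        also have "\<dots> \<le> 2"
          using M(2)[of "fst ij"] M(2)[of "snd ij"] ij h by (auto simp: mult.commute)
        finally have "L * norm (h * real (fst ij), h * real (snd ij)) \<le> L * 2"
          using L by (intro mult_left_mono) auto
        then have "norm (t ij) \<le> 2 * L"
          unfolding t_def using T_le[of "(h * real (fst ij), h * real (snd ij))"] by linarith
        moreover have "dist p (t ij + x) \<le> dist p x + norm (t ij)"
          using dist_triangle[of p "t ij + x" x] by (simp add: dist_norm)
        moreover have "dist p x < r" using x by (simp add: E_def)
        ultimately show "t ij + x \<in> ball p (r + 2 * L)" by simp
      qed
    qed simp
    finally have "real M * real M * measure lebesgue E \<le> V" .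
    moreover have "1 / h * (1 / h) \<le> real M * real M"
      using M(1) h by (intro mult_mono) auto
    ultimately have "1 / h * (1 / h) * measure lebesgue E \<le> V"
      by (meson measure_nonneg mult_right_mono order_trans)
    then have "measure lebesgue E \<le> V * h * h"
      using h by (simp add: field_simps)
    also have "\<dots> = 16 * V / c\<^sup>2 * e\<^sup>2"
      by (simp add: h_def power2_eq_square)
    finally show ?thesis by (simp add: E_def)
  qed
  then show ?thesis using that r by blast
qed

text \<open>Finitely many of the local balls cover \<open>K\<close>, and their constants add up.
  Measurability is included because indicators of these sets are integrated later.\<close>

lemma measure_small_values_compact_le:
  fixes F :: "'a::euclidean_space \<Rightarrow> 'b::euclidean_space"
  assumes \<Omega>: "open \<Omega>" and F: "\<And>x. x \<in> \<Omega> \<Longrightarrow> (F has_derivative F' x) (at x)"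
    and cont: "\<And>h. continuous_on \<Omega> (\<lambda>x. F' x h)"
    and inj: "\<And>p. p \<in> \<Omega> \<Longrightarrow> \<exists>v w. \<forall>a b. F' p (a *\<^sub>R v + b *\<^sub>R w) = 0 \<longrightarrow> a = 0 \<and> b = 0"
    and K: "compact K" "K \<subseteq> \<Omega>"
  shows "\<exists>C\<ge>0. \<forall>e>0. {x \<in> K. norm (F x) < e} \<in> lmeasurable \<and>
    measure lebesgue {x \<in> K. norm (F x) < e} \<le> C * e\<^sup>2"
proof -
  have contF: "continuous_on \<Omega> F"
    using F by (meson continuous_at_imp_continuous_on has_derivative_continuous)
  have meas: "{x \<in> S. norm (F x) < e} \<in> lmeasurable" if "S \<in> lmeasurable" "S \<subseteq> \<Omega>" for S e
  proof -
    have "open (\<Omega> \<inter> (\<lambda>x. norm (F x)) -` {..<e})"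
      using contF \<Omega> by (intro continuous_open_preimage continuous_intros) auto
    then have "S \<inter> (\<Omega> \<inter> (\<lambda>x. norm (F x)) -` {..<e}) \<in> lmeasurable"
      using that by (intro fmeasurable_Int_fmeasurable) auto
    also have "S \<inter> (\<Omega> \<inter> (\<lambda>x. norm (F x)) -` {..<e}) = {x \<in> S. norm (F x) < e}"
      using that by auto
    finally show ?thesis .
  qed
  define Q where "Q p r C \<longleftrightarrow> r > 0 \<and> ball p r \<subseteq> \<Omega> \<and>
      (\<forall>e>0. measure lebesgue {x \<in> ball p r. norm (F x) < e} \<le> C * e\<^sup>2)" for p r C
  have "\<exists>r C. Q p r C" if p: "p \<in> \<Omega>" for p
  proof -
    obtain v w where vw: "\<And>a b. F' p (a *\<^sub>R v + b *\<^sub>R w) = 0 \<Longrightarrow> a = 0 \<and> b = 0"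
      using inj[OF p] by blast
    obtain r C where "r > 0" "ball p r \<subseteq> \<Omega>"
      "\<forall>e>0. measure lebesgue {x \<in> ball p r. norm (F x) < e} \<le> C * e\<^sup>2"
      by (rule measure_small_values_le[OF \<Omega> p F cont vw])
    then show ?thesis unfolding Q_def by blast
  qed
  then obtain r C where "\<And>p. p \<in> \<Omega> \<Longrightarrow> Q p (r p) (C p)" by metis
  then have rC: "\<And>p. p \<in> \<Omega> \<Longrightarrow> r p > 0" "\<And>p. p \<in> \<Omega> \<Longrightarrow> ball p (r p) \<subseteq> \<Omega>"
    "\<And>p e. p \<in> \<Omega> \<Longrightarrow> e > 0 \<Longrightarrow> measure lebesgue {x \<in> ball p (r p). norm (F x) < e} \<le> C p * e\<^sup>2"
    unfolding Q_def by blast+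
  have "K \<subseteq> (\<Union>p\<in>K. ball p (r p))" using rC(1) K by force
  then obtain P where P: "P \<subseteq> K" "finite P" "K \<subseteq> (\<Union>p\<in>P. ball p (r p))"
    using compactE_image[OF K(1), of K "\<lambda>p. ball p (r p)"] by blast
  have mK: "{x \<in> K. norm (F x) < e} \<in> lmeasurable" if "e > 0" for e
    by (intro meas lmeasurable_compact K)
  have bound: "measure lebesgue {x \<in> K. norm (F x) < e} \<le> (\<Sum>p\<in>P. \<bar>C p\<bar>) * e\<^sup>2" if "e > 0" for e
  proof -
    have m: "{x \<in> ball p (r p). norm (F x) < e} \<in> lmeasurable" if "p \<in> P" for p
      using that P(1) K(2) by (intro meas rC(2)) auto
    have "measure lebesgue {x \<in> K. norm (F x) < e} \<le>
        measure lebesgue (\<Union>p\<in>P. {x \<in> ball p (r p). norm (F x) < e})"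
    proof (rule measure_mono_fmeasurable)
      show "{x \<in> K. norm (F x) < e} \<in> sets lebesgue"
        using mK[OF \<open>e > 0\<close>] by (rule fmeasurableD)
      show "(\<Union>p\<in>P. {x \<in> ball p (r p). norm (F x) < e}) \<in> lmeasurable"
        using P(2) m by (rule fmeasurable.finite_UN)
    qed (use P(3) in fastforce)
    also have "\<dots> \<le> (\<Sum>p\<in>P. measure lebesgue {x \<in> ball p (r p). norm (F x) < e})"
      using m P(2) by (intro measure_UNION_le) (auto intro: fmeasurableD)
    also have "\<dots> \<le> (\<Sum>p\<in>P. \<bar>C p\<bar> * e\<^sup>2)"
    proof (rule sum_mono)
      fix p assume "p \<in> P"
      then have "measure lebesgue {x \<in> ball p (r p). norm (F x) < e} \<le> C p * e\<^sup>2"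
        using rC(3)[OF _ \<open>e > 0\<close>] P K by blast
      also have "\<dots> \<le> \<bar>C p\<bar> * e\<^sup>2" by (intro mult_right_mono) auto
      finally show "measure lebesgue {x \<in> ball p (r p). norm (F x) < e} \<le> \<bar>C p\<bar> * e\<^sup>2" .
    qed
    finally show ?thesis by (simp add: sum_distrib_right)
  qed
  have "(\<Sum>p\<in>P. \<bar>C p\<bar>) \<ge> 0" by (simp add: sum_nonneg)
  with mK bound show ?thesis by blast
qed

section \<open>Divergence-free unit fields with small singular set\<close>

text \<open>The zeros in a compact set lie in every sublevel set, whose measure tends to 0 with
  \<open>e\<close>; countably many boxes exhaust \<Omega>.\<close>

lemma small_values_null_set:
  fixes F :: "'a::euclidean_space \<Rightarrow> 'b::euclidean_space"
  assumes \<Omega>: "open \<Omega>"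
    and small: "\<And>K. compact K \<Longrightarrow> K \<subseteq> \<Omega> \<Longrightarrow> \<exists>C\<ge>0. \<forall>e>0. {x \<in> K. norm (F x) < e} \<in> lmeasurable \<and>
      measure lebesgue {x \<in> K. norm (F x) < e} \<le> C * e\<^sup>2"
  shows "AE x in lebesgue. x \<in> \<Omega> \<longrightarrow> F x \<noteq> 0"
proof -
  have K: "AE x in lebesgue. x \<in> K \<longrightarrow> F x \<noteq> 0" if K: "compact K" "K \<subseteq> \<Omega>" for K
  proof -
    obtain C where C: "C \<ge> 0" "\<And>e. e > 0 \<Longrightarrow> {x \<in> K. norm (F x) < e} \<in> lmeasurable"
      "\<And>e. e > 0 \<Longrightarrow> measure lebesgue {x \<in> K. norm (F x) < e} \<le> C * e\<^sup>2"
      using small[OF K] by blast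
    have "negligible {x \<in> K. F x = 0}"
      unfolding negligible_outer_le
    proof (intro allI impI)
      fix e :: real assume e: "e > 0"
      \<comment> \<open>Chosen to make \<open>C * d\<^sup>2\<close> at most \<open>e\<close>; the
        summand 1 covers \<open>C = 0\<close>.\<close>
      define d where "d = sqrt (e / (C + 1))"
      have d: "d > 0" "C * d\<^sup>2 \<le> e"
        using e C(1) by (auto simp: d_def field_simps)
      show "\<exists>T. {x \<in> K. F x = 0} \<subseteq> T \<and> T \<in> lmeasurable \<and> measure lebesgue T \<le> e"
        using C(2)[OF d(1)] C(3)[OF d(1)] d by (intro exI[of _ "{x \<in> K. norm (F x) < d}"]) auto
    qed
    then have "{x \<in> K. F x = 0} \<in> null_sets lebesgue"
      by (simp add: negligible_iff_null_sets)
    from AE_not_in[OF this] show ?thesis by eventually_elim auto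
  qed
  obtain D where D: "countable D" "D \<subseteq> Pow \<Omega>" "\<And>X. X \<in> D \<Longrightarrow> \<exists>a b. X = cbox a b" "\<Union>D = \<Omega>"
    using open_countable_Union_open_cbox[OF \<Omega>] by blast
  have "AE x in lebesgue. \<forall>X\<in>D. x \<in> X \<longrightarrow> F x \<noteq> 0"
  proof (rule AE_ball_countable'[OF _ D(1)])
    fix X assume X: "X \<in> D"
    then have "compact X" using D(3) compact_cbox by blast
    then show "AE x in lebesgue. x \<in> X \<longrightarrow> F x \<noteq> 0" using K X D(2) by blast
  qed
  then show ?thesis
    by eventually_elim (use D(4) in blast)
qed

text \<open>One formula for both fields: \<open>c = 0\<close> gives the unit field away from zeros
  of \<open>F\<close>, and \<open>c = e\<^sup>2\<close> the regularized field everywhere.\<close>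

lemma has_derivative_scaled_field:
  fixes F :: "'a::real_inner \<Rightarrow> 'b::real_inner"
  assumes F: "(F has_derivative F') (at x)" and pos: "F x \<bullet> F x + c > 0"
  defines "R \<equiv> sqrt (F x \<bullet> F x + c)"
  shows "((\<lambda>x. F x /\<^sub>R sqrt (F x \<bullet> F x + c)) has_derivative
    (\<lambda>h. F' h /\<^sub>R R - ((F x \<bullet> F' h) / R ^ 3) *\<^sub>R F x)) (at x)"
proof -
  have R: "R > 0" "R\<^sup>2 = F x \<bullet> F x + c" using pos by (auto simp: R_def)
  have "((\<lambda>x. F x \<bullet> F x + c) has_derivative (\<lambda>h. 2 * (F x \<bullet> F' h))) (at x)"
    by (rule has_derivative_eq_rhs) (auto intro!: derivative_eq_intros F simp: inner_commute)
  from has_derivative_compose[OF this DERIV_real_sqrt[OF pos, unfolded has_field_derivative_def]]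
  have "((\<lambda>x. sqrt (F x \<bullet> F x + c)) has_derivative (\<lambda>h. (F x \<bullet> F' h) / R)) (at x)"
    by (rule has_derivative_eq_rhs) (rule ext, simp add: R_def inverse_eq_divide)
  from Deriv.has_derivative_inverse[OF _ this]
  have "((\<lambda>x. inverse (sqrt (F x \<bullet> F x + c))) has_derivative
      (\<lambda>h. - (inverse R * ((F x \<bullet> F' h) / R) * inverse R))) (at x)"
    using pos by (simp add: R_def)
  then have "((\<lambda>x. inverse (sqrt (F x \<bullet> F x + c))) has_derivative (\<lambda>h. - ((F x \<bullet> F' h) / R ^ 3))) (at x)"
    by (rule has_derivative_eq_rhs) (rule ext, simp add: inverse_eq_divide power3_eq_cube)
  from has_derivative_scaleR[OF this F] show ?thesis
    by (rule has_derivative_eq_rhs) (simp add: R_def)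
qed

lemma divergence_eq:
  assumes "(F has_derivative F') (at x)"
  shows "divergence F x = (\<Sum>b\<in>Basis. F' b \<bullet> b)"
  using frechet_derivative_at[OF assms] by (simp add: divergence_def)

text \<open>If \<open>F / \<bar>F\<bar>\<close> is divergence free, then the divergence of \<open>F / sqrt (\<bar>F\<bar>\<^sup>2 + \<epsilon>\<^sup>2)\<close> is
  \<open>\<epsilon>\<^sup>2 / (\<bar>F\<bar>\<^sup>2 (\<bar>F\<bar>\<^sup>2 + \<epsilon>\<^sup>2)\<^sup>3\<^sup>/\<^sup>2)\<close> times the quadratic form of \<open>F'\<close> at \<open>F\<close>.\<close>

lemma divergence_regularized_le:
  fixes F :: "'a::euclidean_space \<Rightarrow> 'a"
  assumes F: "(F has_derivative F') (at x)" and nz: "F x \<noteq> 0" and e: "e > 0"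
    and div: "divergence (\<lambda>x. F x /\<^sub>R norm (F x)) x = 0"
  defines "R \<equiv> sqrt (F x \<bullet> F x + e\<^sup>2)"
  shows "\<bar>\<Sum>b\<in>Basis. (F' b /\<^sub>R R - ((F x \<bullet> F' b) / R ^ 3) *\<^sub>R F x) \<bullet> b\<bar>
    \<le> (\<Sum>b\<in>Basis. norm (F' b)) * (e\<^sup>2 / R ^ 3)"
proof -
  define r where "r = norm (F x)"
  have r: "r > 0" "r\<^sup>2 = F x \<bullet> F x" using nz by (auto simp: r_def power2_norm_eq_inner)
  have R: "R > 0" "R\<^sup>2 = r\<^sup>2 + e\<^sup>2"
    using r e by (auto simp: R_def add_pos_pos add_nonneg_pos)
  define t where "t = (\<Sum>b\<in>Basis. F' b \<bullet> b)"
  define q where "q = (\<Sum>b\<in>Basis. (F x \<bullet> F' b) * (F x \<bullet> b))"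
  \<comment> \<open>Both divergences have this form with the same trace \<open>t\<close> and
    quadratic form \<open>q\<close>: the unit field has \<open>s = r\<close>, the regularized one
    \<open>s = R\<close>. Vanishing at \<open>r\<close> eliminates \<open>t\<close>.\<close>
  have sum: "(\<Sum>b\<in>Basis. (F' b /\<^sub>R s - ((F x \<bullet> F' b) / s ^ 3) *\<^sub>R F x) \<bullet> b) = t / s - q / s ^ 3" for s
    by (simp add: t_def q_def inner_diff_left sum_subtractf sum_divide_distrib divide_inverse
        sum_distrib_left sum_distrib_right mult_ac)
  have "((\<lambda>x. F x /\<^sub>R norm (F x)) has_derivative
      (\<lambda>h. F' h /\<^sub>R r - ((F x \<bullet> F' h) / r ^ 3) *\<^sub>R F x)) (at x)"
    using has_derivative_scaled_field[OF F, of 0] nz by (simp add: r_def norm_eq_sqrt_inner)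
  from divergence_eq[OF this] have "t / r - q / r ^ 3 = 0"
    unfolding div sum by simp
  then have t: "t = q / r\<^sup>2"
    using r(1) by (simp add: field_simps power2_eq_square power3_eq_cube)
  have "t / R - q / R ^ 3 = q * e\<^sup>2 / (r\<^sup>2 * R ^ 3)"
  proof -
    have "t / R - q / R ^ 3 = q * (R\<^sup>2 - r\<^sup>2) / (r\<^sup>2 * R ^ 3)"
      unfolding t using r(1) R(1) by (simp add: field_simps power2_eq_square power3_eq_cube)
    then show ?thesis by (simp add: R(2))
  qed
  also have "\<bar>q * e\<^sup>2 / (r\<^sup>2 * R ^ 3)\<bar> \<le> (\<Sum>b\<in>Basis. norm (F' b)) * (e\<^sup>2 / R ^ 3)"
  proof -
    \<comment> \<open>Cauchy-Schwarz on both factors produces \<open>r\<^sup>2\<close>, which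
      cancels the one in the denominator, so the bound does not blow up near zeros of
      \<open>F\<close>.\<close>
    have "\<bar>q\<bar> \<le> (\<Sum>b\<in>Basis. \<bar>(F x \<bullet> F' b) * (F x \<bullet> b)\<bar>)"
      unfolding q_def by (rule sum_abs)
    also have "\<dots> \<le> (\<Sum>b\<in>Basis. r\<^sup>2 * norm (F' b))"
    proof (rule sum_mono)
      fix b :: 'a assume "b \<in> Basis"
      have "\<bar>F x \<bullet> F' b\<bar> \<le> r * norm (F' b)" "\<bar>F x \<bullet> b\<bar> \<le> r * 1"
        unfolding r_def using Cauchy_Schwarz_ineq2 Cauchy_Schwarz_ineq2[of "F x" b] \<open>b \<in> Basis\<close> by auto
      then have "\<bar>F x \<bullet> F' b\<bar> * \<bar>F x \<bullet> b\<bar> \<le> (r * norm (F' b)) * (r * 1)"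
        using r(1) by (intro mult_mono) auto
      then show "\<bar>(F x \<bullet> F' b) * (F x \<bullet> b)\<bar> \<le> r\<^sup>2 * norm (F' b)"
        by (simp add: abs_mult power2_eq_square mult_ac)
    qed
    finally have "\<bar>q\<bar> \<le> r\<^sup>2 * (\<Sum>b\<in>Basis. norm (F' b))"
      by (simp add: sum_distrib_left)
    then have "\<bar>q\<bar> * (e\<^sup>2 / (r\<^sup>2 * R ^ 3)) \<le> r\<^sup>2 * (\<Sum>b\<in>Basis. norm (F' b)) * (e\<^sup>2 / (r\<^sup>2 * R ^ 3))"
      using R(1) by (intro mult_right_mono) auto
    then show ?thesis
      using r(1) R(1) by (simp add: abs_mult field_simps)
  qed
  finally show ?thesis by (simp add: sum)
qed

text \<open>The exponents balance the two regions for \<open>\<epsilon> = d\<^sup>5\<close>: where \<open>\<bar>F\<bar> < d\<^sup>3\<close>, the bound \<open>1 / \<epsilon>\<close>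
  meets a set of measure \<open>O(d\<^sup>6)\<close>, and elsewhere the quotient is at most \<open>\<epsilon>\<^sup>2 / d\<^sup>9 = d\<close>.\<close>

lemma regularization_defect_le:
  fixes d s :: real
  assumes d: "d > 0"
  defines "R \<equiv> sqrt (s\<^sup>2 + (d ^ 5)\<^sup>2)"
  shows "(d ^ 5)\<^sup>2 / R ^ 3 \<le> (if \<bar>s\<bar> < d ^ 3 then 1 / d ^ 5 else 0) + d"
proof (cases "\<bar>s\<bar> < d ^ 3")
  case True
  have "d ^ 5 \<le> R"
    unfolding R_def by (rule real_le_rsqrt) simp
  moreover from this have "R > 0" using d by (auto intro: less_le_trans[of _ "d ^ 5"])
  ultimately have "(d ^ 5) ^ 3 \<le> R ^ 3" "R ^ 3 > 0"
    using d power_mono[of "d ^ 5" R 3] by auto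
  then have "(d ^ 5)\<^sup>2 / R ^ 3 \<le> (d ^ 5)\<^sup>2 / (d ^ 5) ^ 3"
    using d by (intro divide_left_mono mult_pos_pos) auto
  also have "\<dots> = 1 / d ^ 5" using d by (simp add: field_simps eval_nat_numeral)
  finally show ?thesis using True d by simp
next
  case False
  have "d ^ 3 \<le> \<bar>s\<bar>" using False by simp
  also have "\<dots> \<le> R" unfolding R_def by (rule real_le_rsqrt) simp
  finally have "d ^ 3 \<le> R" .
  moreover from this have "R > 0" using d by (auto intro: less_le_trans[of _ "d ^ 3"])
  ultimately have "(d ^ 3) ^ 3 \<le> R ^ 3" "R ^ 3 > 0"
    using d power_mono[of "d ^ 3" R 3] by auto
  then have "(d ^ 5)\<^sup>2 / R ^ 3 \<le> (d ^ 5)\<^sup>2 / (d ^ 3) ^ 3"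
    using d by (intro divide_left_mono mult_pos_pos) auto
  also have "\<dots> = d"
    using d by (simp add: power_mult[symmetric] eval_nat_numeral)
  finally show ?thesis using False by simp
qed

section \<open>Removing the regularization\<close>

lemma integral_by_parts_field:
  fixes G :: "'a::euclidean_space \<Rightarrow> 'a"
  assumes \<Omega>: "open \<Omega>" and G: "\<And>x. x \<in> \<Omega> \<Longrightarrow> (G has_derivative G' x) (at x)"
    and cont: "\<And>h. continuous_on \<Omega> (\<lambda>x. G' x h)" and \<phi>: "test_function \<Omega> \<phi>"
  shows "(LINT x:\<Omega>|lebesgue. G x \<bullet> grad \<phi> x) = - (LINT x:\<Omega>|lebesgue. \<phi> x * (\<Sum>b\<in>Basis. G' x b \<bullet> b))"
proof -
  obtain K where K: "compact K" "K \<subseteq> \<Omega>" "\<And>x. x \<notin> K \<Longrightarrow> \<phi> x = 0" "\<And>x. x \<notin> K \<Longrightarrow> grad \<phi> x = 0"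
    and d: "\<And>x. \<phi> differentiable (at x)" and c: "continuous_on UNIV \<phi>" "continuous_on UNIV (grad \<phi>)"
    using test_functionD[OF \<phi>] by blast
  note c\<Omega> = continuous_on_subset[OF c(1) subset_UNIV] continuous_on_subset[OF c(2) subset_UNIV]
  have cG: "continuous_on \<Omega> G"
    by (intro continuous_at_imp_continuous_on ballI has_derivative_continuous[OF G])
  have int: "set_integrable lebesgue \<Omega> (\<lambda>x. (G x \<bullet> b) * (grad \<phi> x \<bullet> b))"
    "set_integrable lebesgue \<Omega> (\<lambda>x. \<phi> x * (G' x b \<bullet> b))" for b
    using \<Omega> K by (intro set_integrable_compact_support[of _ K] continuous_intros cG c\<Omega> cont; auto)+
  have "(LINT x:\<Omega>|lebesgue. G x \<bullet> grad \<phi> x) = (LINT x:\<Omega>|lebesgue. \<Sum>b\<in>Basis. (G x \<bullet> b) * (grad \<phi> x \<bullet> b))"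
    by (subst euclidean_inner) (rule refl)
  also have "\<dots> = (\<Sum>b\<in>Basis. LINT x:\<Omega>|lebesgue. (G x \<bullet> b) * (grad \<phi> x \<bullet> b))"
    using int(1) unfolding set_lebesgue_integral_def set_integrable_def scaleR_sum_right
    by (rule Bochner_Integration.integral_sum)
  also have "\<dots> = (\<Sum>b\<in>Basis. - (LINT x:\<Omega>|lebesgue. \<phi> x * (G' x b \<bullet> b)))"
    by (intro sum.cong refl integral_by_parts_test_function \<Omega> \<phi> has_derivative_inner_left G
        continuous_intros cont)
  also have "\<dots> = - (\<Sum>b\<in>Basis. LINT x:\<Omega>|lebesgue. \<phi> x * (G' x b \<bullet> b))"
    by (rule sum_negf)
  also have "(\<Sum>b\<in>Basis. LINT x:\<Omega>|lebesgue. \<phi> x * (G' x b \<bullet> b)) =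
      (LINT x:\<Omega>|lebesgue. \<Sum>b\<in>Basis. \<phi> x * (G' x b \<bullet> b))"
    using int(2) unfolding set_lebesgue_integral_def set_integrable_def scaleR_sum_right
    by (rule Bochner_Integration.integral_sum[symmetric])
  finally show ?thesis by (simp add: sum_distrib_left)
qed

text \<open>Integration by parts is exact for the regularized fields, since they are differentiable
  across the zeros of \<open>F\<close>. Their length is at most 1, so
  \<open>norm (grad \<phi> x)\<close> dominates in the limit. The geometry of the zero set enters
  through \<open>small\<close>.\<close>

lemma integral_unit_field_eq_0:
  fixes F :: "'a::euclidean_space \<Rightarrow> 'a"
  assumes \<Omega>: "open \<Omega>" and F: "\<And>x. x \<in> \<Omega> \<Longrightarrow> (F has_derivative F' x) (at x)"
    and cont: "\<And>h. continuous_on \<Omega> (\<lambda>x. F' x h)"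
    and small: "\<And>K. compact K \<Longrightarrow> K \<subseteq> \<Omega> \<Longrightarrow> \<exists>C\<ge>0. \<forall>e>0. {x \<in> K. norm (F x) < e} \<in> lmeasurable \<and>
      measure lebesgue {x \<in> K. norm (F x) < e} \<le> C * e\<^sup>2"
    and div: "\<And>x. x \<in> \<Omega> \<Longrightarrow> F x \<noteq> 0 \<Longrightarrow> divergence (\<lambda>x. F x /\<^sub>R norm (F x)) x = 0"
    and \<phi>: "test_function \<Omega> \<phi>"
  shows "(LINT x:\<Omega>|lebesgue. (F x /\<^sub>R norm (F x)) \<bullet> grad \<phi> x) = 0"
proof -
  obtain K where K: "compact K" "K \<subseteq> \<Omega>" "\<And>x. x \<notin> K \<Longrightarrow> \<phi> x = 0" "\<And>x. x \<notin> K \<Longrightarrow> grad \<phi> x = 0"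
    and d: "\<And>x. \<phi> differentiable (at x)" and c: "continuous_on UNIV \<phi>" "continuous_on UNIV (grad \<phi>)"
    using test_functionD[OF \<phi>] by blast
  note c\<Omega> = continuous_on_subset[OF c(1) subset_UNIV] continuous_on_subset[OF c(2) subset_UNIV]
  have cF: "continuous_on \<Omega> F"
    by (intro continuous_at_imp_continuous_on ballI has_derivative_continuous[OF F])
  have Kmeas: "K \<in> lmeasurable" using K(1) by (rule lmeasurable_compact)
  obtain C where C: "C \<ge> 0" "\<And>e. e > 0 \<Longrightarrow> {x \<in> K. norm (F x) < e} \<in> lmeasurable"
    "\<And>e. e > 0 \<Longrightarrow> measure lebesgue {x \<in> K. norm (F x) < e} \<le> C * e\<^sup>2"
    using small[OF K(1,2)] by blast
  have nz: "AE x in lebesgue. x \<in> \<Omega> \<longrightarrow> F x \<noteq> 0"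
    using \<Omega> small by (rule small_values_null_set)
  have "continuous_on K (\<lambda>x. \<bar>\<phi> x\<bar> * (\<Sum>b\<in>Basis. norm (F' x b)))"
    using K(2) by (intro continuous_intros continuous_on_subset[OF cont] continuous_on_subset[OF c(1)]) auto
  then have "bounded ((\<lambda>x. \<bar>\<phi> x\<bar> * (\<Sum>b\<in>Basis. norm (F' x b))) ` K)"
    using K(1) by (intro compact_imp_bounded compact_continuous_image)
  then obtain B0 where B0: "\<And>x. x \<in> K \<Longrightarrow> \<bar>\<bar>\<phi> x\<bar> * (\<Sum>b\<in>Basis. norm (F' x b))\<bar> \<le> B0"
    unfolding bounded_iff by auto
  define B where "B = max B0 1"
  have B: "B > 0" "\<And>x. x \<in> K \<Longrightarrow> \<bar>\<phi> x\<bar> * (\<Sum>b\<in>Basis. norm (F' x b)) \<le> B"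
    using B0 by (auto simp: B_def intro: order_trans[OF abs_ge_self] le_max_iff_disj[THEN iffD2])
  define R where "R e x = sqrt (F x \<bullet> F x + e\<^sup>2)" for e x
  define G where "G e x = F x /\<^sub>R R e x" for e x
  define G' where "G' e x h = F' x h /\<^sub>R R e x - ((F x \<bullet> F' x h) / R e x ^ 3) *\<^sub>R F x" for e x h
  have R: "R e x > 0" "norm (F x) \<le> R e x" if "e > 0" for e x
    using that by (auto simp: R_def norm_eq_sqrt_inner add_nonneg_pos)
  have G: "(G e has_derivative G' e x) (at x)" if "e > 0" "x \<in> \<Omega>" for e x
    unfolding G_def[abs_def] G'_def[abs_def] R_def
    using that by (intro has_derivative_scaled_field F) (auto simp: add_nonneg_pos)
  have contR: "continuous_on \<Omega> (R e)" for e
    unfolding R_def[abs_def] by (intro continuous_intros cF)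
  have contG': "continuous_on \<Omega> (\<lambda>x. G' e x h)" if "e > 0" for e h
    unfolding G'_def using R(1)[OF that] by (intro continuous_intros cF cont contR) (auto simp: less_imp_neq[symmetric])
  have contG: "continuous_on \<Omega> (G e)" if "e > 0" for e
    unfolding G_def[abs_def] using R(1)[OF that] by (intro continuous_intros cF contR) (auto simp: less_imp_neq[symmetric])
  have G_le: "norm (G e x) \<le> 1" if "e > 0" for e x
    using R[OF that, of x] by (simp add: G_def field_simps)
  have est: "\<bar>LINT x:\<Omega>|lebesgue. G (s ^ 5) x \<bullet> grad \<phi> x\<bar> \<le> B * (C + measure lebesgue K) * s"
    if s: "s > 0" for s
  proof -
    let ?e = "s ^ 5"
    let ?E = "{x \<in> K. norm (F x) < s ^ 3}"
    let ?w = "\<lambda>x. B * (1 / ?e * indicator ?E x + s * indicator K x)"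
    have e: "?e > 0" and s3: "s ^ 3 > 0" using s by auto
    have ind: "integrable lebesgue (\<lambda>x. indicator ?E x :: real)" "integrable lebesgue (\<lambda>x. indicator K x :: real)"
      using C(2)[OF s3] Kmeas by (simp_all flip: lmeasurable_iff_integrable)
    have "(LINT x:\<Omega>|lebesgue. G ?e x \<bullet> grad \<phi> x) =
        - (LINT x:\<Omega>|lebesgue. \<phi> x * (\<Sum>b\<in>Basis. G' ?e x b \<bullet> b))"
      by (intro integral_by_parts_field \<Omega> \<phi> G contG' e)
    then have "\<bar>LINT x:\<Omega>|lebesgue. G ?e x \<bullet> grad \<phi> x\<bar> =
        norm (LINT x|lebesgue. indicator \<Omega> x *\<^sub>R (\<phi> x * (\<Sum>b\<in>Basis. G' ?e x b \<bullet> b)))"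
      by (simp add: set_lebesgue_integral_def)
    also have "\<dots> \<le> (LINT x|lebesgue. norm (indicator \<Omega> x *\<^sub>R (\<phi> x * (\<Sum>b\<in>Basis. G' ?e x b \<bullet> b))))"
      by (rule integral_norm_bound)
    also have "\<dots> \<le> (LINT x|lebesgue. ?w x)"
    proof (rule integral_mono_AE)
      have "set_integrable lebesgue \<Omega> (\<lambda>x. \<phi> x * (\<Sum>b\<in>Basis. G' ?e x b \<bullet> b))"
        using \<Omega> K by (intro set_integrable_compact_support[of _ K] continuous_intros c\<Omega> contG' e) auto
      then show "integrable lebesgue (\<lambda>x. norm (indicator \<Omega> x *\<^sub>R (\<phi> x * (\<Sum>b\<in>Basis. G' ?e x b \<bullet> b))))"
        unfolding set_integrable_def by (rule integrable_norm)
      show "integrable lebesgue ?w"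
        by (intro integrable_mult_right Bochner_Integration.integrable_add ind)
      \<comment> \<open>The pointwise divergence bound rests on \<open>div\<close>, which says
        nothing at zeros of \<open>F\<close>; these form a null set by \<open>nz\<close>.\<close>
      show "AE x in lebesgue. norm (indicator \<Omega> x *\<^sub>R (\<phi> x * (\<Sum>b\<in>Basis. G' ?e x b \<bullet> b))) \<le> ?w x"
        using nz
      proof eventually_elim
        fix x assume nz: "x \<in> \<Omega> \<longrightarrow> F x \<noteq> 0"
        show "norm (indicator \<Omega> x *\<^sub>R (\<phi> x * (\<Sum>b\<in>Basis. G' ?e x b \<bullet> b))) \<le> ?w x"
        proof (cases "x \<in> K")
          case True
          then have x: "x \<in> \<Omega>" "F x \<noteq> 0" using nz K(2) by auto
          have "\<bar>\<Sum>b\<in>Basis. G' ?e x b \<bullet> b\<bar> \<le> (\<Sum>b\<in>Basis. norm (F' x b)) * (?e\<^sup>2 / R ?e x ^ 3)"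
            unfolding G'_def R_def by (rule divergence_regularized_le[OF F[OF x(1)] x(2) e div[OF x]])
          then have "\<bar>\<phi> x\<bar> * \<bar>\<Sum>b\<in>Basis. G' ?e x b \<bullet> b\<bar> \<le>
              \<bar>\<phi> x\<bar> * ((\<Sum>b\<in>Basis. norm (F' x b)) * (?e\<^sup>2 / R ?e x ^ 3))"
            by (rule mult_left_mono) simp
          also have "\<dots> = \<bar>\<phi> x\<bar> * (\<Sum>b\<in>Basis. norm (F' x b)) * (?e\<^sup>2 / R ?e x ^ 3)"
            by (simp only: mult.assoc)
          also have "\<dots> \<le> B * (?e\<^sup>2 / R ?e x ^ 3)"
            using B(2)[OF True] R(1)[OF e, of x] by (intro mult_right_mono) auto
          also have "\<dots> \<le> B * ((if \<bar>norm (F x)\<bar> < s ^ 3 then 1 / ?e else 0) + s)"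
            using regularization_defect_le[OF s, of "norm (F x)"] B(1)
            by (intro mult_left_mono) (auto simp: R_def power2_norm_eq_inner)
          also have "\<dots> = ?w x" using True by simp
          finally show ?thesis using x(1) by (simp add: abs_mult)
        qed (simp add: K(3))
      qed
    qed
    also have "(LINT x|lebesgue. ?w x) = B * (1 / ?e * measure lebesgue ?E + s * measure lebesgue K)"
      using ind by (simp del: times_divide_eq_left)
    also have "\<dots> \<le> B * (1 / ?e * (C * (s ^ 3)\<^sup>2) + s * measure lebesgue K)"
      using C(3)[OF s3] B(1) e by (intro mult_left_mono add_right_mono) auto
    also have "\<dots> = B * (C + measure lebesgue K) * s"
      using s by (simp add: field_simps eval_nat_numeral)
    finally show ?thesis .
  qed
  define s where "s n = inverse (real (Suc n))" for n
  have s: "s n > 0" for n by (simp add: s_def)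
  have s0: "s \<longlonglongrightarrow> 0" unfolding s_def by (rule LIMSEQ_inverse_real_of_nat)
  have "(\<lambda>n. LINT x:\<Omega>|lebesgue. G (s n ^ 5) x \<bullet> grad \<phi> x) \<longlonglongrightarrow> 0"
  proof (rule Lim_null_comparison)
    show "\<forall>\<^sub>F n in sequentially. norm (LINT x:\<Omega>|lebesgue. G (s n ^ 5) x \<bullet> grad \<phi> x)
        \<le> B * (C + measure lebesgue K) * s n"
      using est s by simp
    show "(\<lambda>n. B * (C + measure lebesgue K) * s n) \<longlonglongrightarrow> 0"
      using tendsto_mult_left[OF s0] by simp
  qed
  moreover have "(\<lambda>n. LINT x:\<Omega>|lebesgue. G (s n ^ 5) x \<bullet> grad \<phi> x) \<longlonglongrightarrow>
      (LINT x:\<Omega>|lebesgue. (F x /\<^sub>R norm (F x)) \<bullet> grad \<phi> x)"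
    unfolding set_lebesgue_integral_def
  proof (rule integral_dominated_convergence)
    have int: "set_integrable lebesgue \<Omega> (\<lambda>x. G (s n ^ 5) x \<bullet> grad \<phi> x)" for n
      using \<Omega> K s[of n] by (intro set_integrable_compact_support[of _ K] continuous_intros c\<Omega> contG) auto
    then show m: "(\<lambda>x. indicator \<Omega> x *\<^sub>R (G (s n ^ 5) x \<bullet> grad \<phi> x)) \<in> borel_measurable lebesgue" for n
      unfolding set_integrable_def by (rule borel_measurable_integrable)
    \<comment> \<open>Convergence holds at every point: where \<open>F x = 0\<close>, all terms are
      0. This also yields measurability of the limit.\<close>
    have lim: "(\<lambda>n. indicator \<Omega> x *\<^sub>R (G (s n ^ 5) x \<bullet> grad \<phi> x)) \<longlonglongrightarrow>
        indicator \<Omega> x *\<^sub>R ((F x /\<^sub>R norm (F x)) \<bullet> grad \<phi> x)" for x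
    proof (cases "F x = 0")
      case False
      have "(\<lambda>n. R (s n ^ 5) x) \<longlonglongrightarrow> sqrt (F x \<bullet> F x + (0 ^ 5)\<^sup>2)"
        unfolding R_def by (intro tendsto_intros s0)
      then have "(\<lambda>n. R (s n ^ 5) x) \<longlonglongrightarrow> norm (F x)"
        by (simp add: norm_eq_sqrt_inner)
      then show ?thesis
        unfolding G_def using False by (intro tendsto_intros) auto
    qed (simp add: G_def)
    then show "AE x in lebesgue. (\<lambda>n. indicator \<Omega> x *\<^sub>R (G (s n ^ 5) x \<bullet> grad \<phi> x)) \<longlonglongrightarrow>
        indicator \<Omega> x *\<^sub>R ((F x /\<^sub>R norm (F x)) \<bullet> grad \<phi> x)"
      by simp
    show "(\<lambda>x. indicator \<Omega> x *\<^sub>R ((F x /\<^sub>R norm (F x)) \<bullet> grad \<phi> x)) \<in> borel_measurable lebesgue"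
      using lim m by (rule borel_measurable_LIMSEQ_metric[rotated])
    have "set_integrable lebesgue \<Omega> (\<lambda>x. norm (grad \<phi> x))"
      using \<Omega> K by (intro set_integrable_compact_support[of _ K] continuous_intros c\<Omega>) auto
    then show "integrable lebesgue (\<lambda>x. indicator \<Omega> x *\<^sub>R norm (grad \<phi> x))"
      by (simp add: set_integrable_def)
    show "AE x in lebesgue. norm (indicator \<Omega> x *\<^sub>R (G (s n ^ 5) x \<bullet> grad \<phi> x))
        \<le> indicator \<Omega> x *\<^sub>R norm (grad \<phi> x)" for n
    proof (rule AE_I2)
      fix x
      have "\<bar>G (s n ^ 5) x \<bullet> grad \<phi> x\<bar> \<le> norm (G (s n ^ 5) x) * norm (grad \<phi> x)"
        by (rule Cauchy_Schwarz_ineq2)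
      also have "\<dots> \<le> 1 * norm (grad \<phi> x)"
        using G_le[of "s n ^ 5" x] s[of n] by (intro mult_right_mono) auto
      finally show "norm (indicator \<Omega> x *\<^sub>R (G (s n ^ 5) x \<bullet> grad \<phi> x))
        \<le> indicator \<Omega> x *\<^sub>R norm (grad \<phi> x)"
        by (simp add: abs_mult mult_left_mono)
    qed
  qed
  ultimately show ?thesis
    by (rule LIMSEQ_unique[rotated])
qed

section \<open>The \<open>p\<close>-minimal surface equation\<close>

text \<open>By completeness of \<open>lebesgue\<close>, measurability of the \<open>g\<close> side
  passes to the \<open>f\<close> side. The sets may differ, because the singular set of a chosen
  weak gradient has to be cut out of the domain.\<close>

lemma set_lebesgue_integral_cong_AE_lebesgue:
  fixes f g :: "'a::euclidean_space \<Rightarrow> 'b::euclidean_space"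
  assumes "(\<lambda>x. indicator S x *\<^sub>R g x) \<in> borel_measurable lebesgue"
    and "AE x in lebesgue. indicator S x *\<^sub>R g x = indicator T x *\<^sub>R f x"
  shows "(LINT x:T|lebesgue. f x) = (LINT x:S|lebesgue. g x)"
  unfolding set_lebesgue_integral_def
proof (rule integral_cong_AE)
  show "(\<lambda>x. indicator T x *\<^sub>R f x) \<in> borel_measurable lebesgue"
    using assms by (rule borel_measurable_AE)
  show "AE x in lebesgue. indicator T x *\<^sub>R f x = indicator S x *\<^sub>R g x"
    using assms(2) by eventually_elim simp
qed (rule assms)

lemma set_integrable_cong_AE_lebesgue:
  fixes f g :: "'a::euclidean_space \<Rightarrow> 'b::euclidean_space"
  assumes "set_integrable lebesgue S g" and "AE x in lebesgue. x \<in> S \<longrightarrow> g x = f x"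
  shows "set_integrable lebesgue S f"
  unfolding set_integrable_def
proof (rule integrable_cong_AE_imp[OF assms(1)[unfolded set_integrable_def]])
  show *: "AE x in lebesgue. indicator S x *\<^sub>R g x = indicator S x *\<^sub>R f x"
    using assms(2) by eventually_elim (auto simp: indicator_def)
  show "(\<lambda>x. indicator S x *\<^sub>R f x) \<in> borel_measurable lebesgue"
    using borel_measurable_integrable[OF assms(1)[unfolded set_integrable_def]] * by (rule borel_measurable_AE)
qed

section \<open>Algebra of \<open>X_star\<close> and consequences for smooth solutions\<close>

lemma X_star_skew: "X_star v \<bullet> w = - (v \<bullet> X_star w)"
  unfolding inner_vec_def
  by (simp add: X_star_def sum_2 vector_2 sum_negf[symmetric] algebra_simps)

lemma inner_X_star_X_star: "X_star v \<bullet> X_star v = v \<bullet> v"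
  unfolding inner_vec_def
  by (simp add: X_star_def sum_2 vector_2 algebra_simps)

lemma linear_X_star: "linear X_star"
  by (rule linearI) (simp_all add: X_star_def vec_eq_iff forall_2 vector_2)

locale C2_p_minimal =
  fixes \<Omega> :: "(real^2^'n) set" and u :: "real^2^'n \<Rightarrow> real"
  assumes card: "CARD('n) \<ge> 2" and \<Omega>: "open \<Omega>" and sol: "C2_solution \<Omega> u"
begin

definition "F x = grad u x - X_star x"

abbreviation "N \<equiv> N_field (grad u)"

lemma N_eq: "N x = F x /\<^sub>R norm (F x)"
  by (simp add: N_field_def F_def)

lemma has_weak_grad_u: "has_weak_grad \<Omega> u (grad u)"
  using sol \<Omega> by (intro has_weak_grad_grad[of _ 1]) (simp_all add: C2_solution_def numeral_2_eq_2)

text \<open>Proved jointly because all three facts depend on the same Hessian \<open>H\<close>. The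
  assumption on \<open>CARD('n)\<close> becomes \<open>dim\<close>, and \<open>X_star\<close> is
  injective because it preserves length.\<close>

lemma F_null_and_integral:
  shows F_nonzero_AE: "AE x in lebesgue. x \<in> \<Omega> \<longrightarrow> F x \<noteq> 0"
    and integral_N_grad: "test_function \<Omega> \<phi> \<Longrightarrow> (LINT x:\<Omega>|lebesgue. N x \<bullet> grad \<phi> x) = 0"
    and continuous_on_F: "continuous_on \<Omega> F"
proof -
  have C2: "Ck_on 2 u \<Omega>" using sol by (simp add: C2_solution_def)
  obtain H where H: "\<And>x. x \<in> \<Omega> \<Longrightarrow> (grad u has_derivative H x) (at x)"
    and contH: "\<And>h. continuous_on \<Omega> (\<lambda>x. H x h)"
    and sym: "\<And>x v w. x \<in> \<Omega> \<Longrightarrow> H x v \<bullet> w = v \<bullet> H x w"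
    using Ck_on_2_grad[OF \<Omega> C2] by blast
  have F': "(F has_derivative (\<lambda>h. H x h - X_star h)) (at x)" if "x \<in> \<Omega>" for x
    unfolding F_def[abs_def]
    by (intro has_derivative_diff H that linear_imp_has_derivative linear_X_star)
  have contF': "continuous_on \<Omega> (\<lambda>x. H x h - X_star h)" for h
    by (intro continuous_intros contH)
  have inj: "\<exists>v w. \<forall>a b. H p (a *\<^sub>R v + b *\<^sub>R w) - X_star (a *\<^sub>R v + b *\<^sub>R w) = 0 \<longrightarrow> a = 0 \<and> b = 0"
    if p: "p \<in> \<Omega>" for p
  proof -
    have dim: "DIM(real^2^'n) > 2"
      using card by simp
    have X0: "v = 0" if "X_star v = 0" for v :: "real^2^'n"
      using inner_X_star_X_star[of v] that by simp
    show ?thesis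
      by (rule exists_plane_injective_symmetric_minus_skew[OF dim has_derivative_linear[OF H[OF p]]
          linear_X_star sym[OF p] X_star_skew X0])
  qed
  have small: "\<exists>C\<ge>0. \<forall>e>0. {x \<in> K. norm (F x) < e} \<in> lmeasurable \<and>
      measure lebesgue {x \<in> K. norm (F x) < e} \<le> C * e\<^sup>2" if K: "compact K" "K \<subseteq> \<Omega>" for K
    by (rule measure_small_values_compact_le[OF \<Omega> F' contF' inj K])
  show "AE x in lebesgue. x \<in> \<Omega> \<longrightarrow> F x \<noteq> 0"
    using \<Omega> small by (rule small_values_null_set)
  have N: "N = (\<lambda>x. F x /\<^sub>R norm (F x))"
    by (rule ext) (rule N_eq)
  have "divergence (\<lambda>x. F x /\<^sub>R norm (F x)) x = 0" if "x \<in> \<Omega>" "F x \<noteq> 0" for x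
    using sol that unfolding N[symmetric] by (auto simp: C2_solution_def sing_set_def F_def)
  then show "test_function \<Omega> \<phi> \<Longrightarrow> (LINT x:\<Omega>|lebesgue. N x \<bullet> grad \<phi> x) = 0"
    unfolding N by (intro integral_unit_field_eq_0[OF \<Omega> F' contF' small])
  show "continuous_on \<Omega> F"
    by (intro continuous_at_imp_continuous_on ballI has_derivative_continuous[OF F'])
qed

text \<open>Together with \<open>N_inner_F\<close> this makes N a calibration: its length is at most
  1 and it attains \<open>norm (F x)\<close> on \<open>F x\<close>. Both hold at singular points
  too, where \<open>N x\<close> is 0.\<close>

lemma norm_N_le: "norm (N x) \<le> 1"
  by (simp add: N_eq divide_simps)

lemma N_inner_F: "N x \<bullet> F x = norm (F x)"
  by (cases "F x = 0") (simp_all add: N_eq power2_norm_eq_inner[symmetric] power2_eq_square)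

lemma measurable_N: "(\<lambda>x. indicator \<Omega> x *\<^sub>R N x) \<in> borel_measurable lebesgue"
proof -
  have [measurable]: "(\<lambda>x. indicator \<Omega> x *\<^sub>R F x) \<in> borel_measurable borel"
    using \<Omega> continuous_on_F by (intro borel_measurable_continuous_on_indicator) auto
  have "(\<lambda>x. (indicator \<Omega> x *\<^sub>R F x) /\<^sub>R norm (indicator \<Omega> x *\<^sub>R F x)) \<in> borel_measurable borel"
    by measurable
  also have "(\<lambda>x. (indicator \<Omega> x *\<^sub>R F x) /\<^sub>R norm (indicator \<Omega> x *\<^sub>R F x)) = (\<lambda>x. indicator \<Omega> x *\<^sub>R N x)"
    by (auto simp: N_eq indicator_def)
  finally show ?thesis by (intro measurable_completion) simp
qed

lemma set_integrable_N_inner: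
  assumes P: "set_integrable lebesgue \<Omega> P"
  shows "set_integrable lebesgue \<Omega> (\<lambda>x. N x \<bullet> P x)"
    and "\<bar>LINT x:\<Omega>|lebesgue. N x \<bullet> P x\<bar> \<le> (LINT x:\<Omega>|lebesgue. norm (P x))"
proof -
  have le: "norm (N x \<bullet> P x) \<le> norm (P x)" for x
    using Cauchy_Schwarz_ineq2[of "N x" "P x"] mult_right_mono[OF norm_N_le[of x] norm_ge_zero[of "P x"]]
    by simp
  have int: "integrable lebesgue (\<lambda>x. norm (indicator \<Omega> x *\<^sub>R P x))"
    using P by (simp only: set_integrable_def integrable_norm)
  have "(\<lambda>x. (indicator \<Omega> x *\<^sub>R N x) \<bullet> (indicator \<Omega> x *\<^sub>R P x)) \<in> borel_measurable lebesgue"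
    using P unfolding set_integrable_def
    by (intro borel_measurable_inner measurable_N borel_measurable_integrable)
  also have "(\<lambda>x. (indicator \<Omega> x *\<^sub>R N x) \<bullet> (indicator \<Omega> x *\<^sub>R P x)) = (\<lambda>x. indicator \<Omega> x *\<^sub>R (N x \<bullet> P x))"
    by (auto simp: indicator_def)
  finally have "integrable lebesgue (\<lambda>x. indicator \<Omega> x *\<^sub>R (N x \<bullet> P x))"
    by (rule Bochner_Integration.integrable_bound[OF int]) (use le in \<open>auto simp: indicator_def\<close>)
  then show NP: "set_integrable lebesgue \<Omega> (\<lambda>x. N x \<bullet> P x)"
    by (simp add: set_integrable_def)
  have "norm (LINT x:\<Omega>|lebesgue. N x \<bullet> P x) \<le> (LINT x:\<Omega>|lebesgue. norm (N x \<bullet> P x))"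
    by (rule set_integral_norm_bound[OF NP])
  also have "\<dots> \<le> (LINT x:\<Omega>|lebesgue. norm (P x))"
    by (intro set_integral_mono set_integrable_norm NP P le)
  finally show "\<bar>LINT x:\<Omega>|lebesgue. N x \<bullet> P x\<bar> \<le> (LINT x:\<Omega>|lebesgue. norm (P x))"
    by simp
qed

lemma weak_grad_u_AE: "AE x in lebesgue. x \<in> \<Omega> \<longrightarrow> weak_grad \<Omega> u x = grad u x"
  by (rule weak_grad_AE_eq[OF \<Omega> has_weak_grad_u])

text \<open>The inequality holds with equality: the singular set is null, so the first integral is
  0, and the second is the distributional divergence of N tested against
  \<open>\<phi>\<close>.\<close>

lemma weak_solution_u: "weak_solution \<Omega> u"
  unfolding weak_solution_def
proof (intro conjI allI impI)
  let ?W = "weak_grad \<Omega> u"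
  show "weakly_differentiable \<Omega> u"
    using has_weak_grad_u by (auto simp: weakly_differentiable_def)
  fix \<phi> assume \<phi>: "test_function \<Omega> \<phi>"
  obtain K where K: "compact K" "K \<subseteq> \<Omega>" "\<And>x. x \<notin> K \<Longrightarrow> \<phi> x = 0" "\<And>x. x \<notin> K \<Longrightarrow> grad \<phi> x = 0"
    and d: "\<And>x. \<phi> differentiable (at x)" and c: "continuous_on UNIV \<phi>" "continuous_on UNIV (grad \<phi>)"
    using test_functionD[OF \<phi>] by blast
  have int: "set_integrable lebesgue \<Omega> (grad \<phi>)"
    using \<Omega> K by (intro set_integrable_compact_support[of _ K] continuous_on_subset[OF c(2)]) auto
  have reg: "AE x in lebesgue. x \<in> \<Omega> \<longrightarrow> ?W x = grad u x \<and> x \<notin> sing_set \<Omega> ?W"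
    using weak_grad_u_AE F_nonzero_AE by eventually_elim (auto simp: sing_set_def F_def)
  have "(LINT x : sing_set \<Omega> ?W | lebesgue. norm (grad \<phi> x)) = 0"
    unfolding set_lebesgue_integral_def
  proof (rule integral_eq_zero_AE)
    show "AE x in lebesgue. indicator (sing_set \<Omega> ?W) x *\<^sub>R norm (grad \<phi> x) = 0"
      using reg by eventually_elim (auto simp: indicator_def sing_set_def)
  qed
  \<comment> \<open>The representative \<open>?W\<close> and its singular set may be altered on a
    null set, so the comparison is made almost everywhere.\<close>
  moreover have "(LINT x : \<Omega> - sing_set \<Omega> ?W | lebesgue. N_field ?W x \<bullet> grad \<phi> x) =
      (LINT x:\<Omega>|lebesgue. N x \<bullet> grad \<phi> x)"
  proof (rule set_lebesgue_integral_cong_AE_lebesgue)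
    show "(\<lambda>x. indicator \<Omega> x *\<^sub>R (N x \<bullet> grad \<phi> x)) \<in> borel_measurable lebesgue"
      using set_integrable_N_inner(1)[OF int] unfolding set_integrable_def by (rule borel_measurable_integrable)
    show "AE x in lebesgue. indicator \<Omega> x *\<^sub>R (N x \<bullet> grad \<phi> x) =
        indicator (\<Omega> - sing_set \<Omega> ?W) x *\<^sub>R (N_field ?W x \<bullet> grad \<phi> x)"
      using reg by eventually_elim (auto simp: indicator_def N_field_def)
  qed
  ultimately show "(LINT x : sing_set \<Omega> ?W | lebesgue. norm (grad \<phi> x)) +
      (LINT x : \<Omega> - sing_set \<Omega> ?W | lebesgue. N_field ?W x \<bullet> grad \<phi> x) \<ge> 0"
    using integral_N_grad[OF \<phi>] by simp
qed

text \<open>As N has length at most 1, this integral is bounded by \<open>W11_norm\<close> of the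
  function paired with N. It vanishes on test functions, so subtracting \<open>\<psi> k\<close> does
  not change its value.\<close>

lemma integral_N_W11_0:
  assumes "\<phi> \<in> W11_0 \<Omega>"
  shows "(LINT x:\<Omega>|lebesgue. N x \<bullet> weak_grad \<Omega> \<phi> x) = 0"
proof -
  let ?P = "weak_grad \<Omega> \<phi>"
  obtain \<psi> where \<psi>: "\<And>k. test_function \<Omega> (\<psi> k)"
    and lim: "(\<lambda>k::nat. W11_norm \<Omega> (\<lambda>x. \<phi> x - \<psi> k x)) \<longlonglongrightarrow> 0"
    and P: "set_integrable lebesgue \<Omega> ?P" "has_weak_grad \<Omega> \<phi> ?P"
    using assms has_weak_grad_weak_grad[of \<Omega> \<phi>] unfolding W11_0_def W11_def by blast
  have "\<bar>LINT x:\<Omega>|lebesgue. N x \<bullet> ?P x\<bar> \<le> W11_norm \<Omega> (\<lambda>x. \<phi> x - \<psi> k x)" for k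
  proof -
    obtain K where K: "compact K" "K \<subseteq> \<Omega>" "\<And>x. x \<notin> K \<Longrightarrow> \<psi> k x = 0" "\<And>x. x \<notin> K \<Longrightarrow> grad (\<psi> k) x = 0"
      and d: "\<And>x. \<psi> k differentiable (at x)" and c: "continuous_on UNIV (\<psi> k)" "continuous_on UNIV (grad (\<psi> k))"
      using test_functionD[OF \<psi>] by blast
    have int: "set_integrable lebesgue \<Omega> (grad (\<psi> k))"
      using \<Omega> K by (intro set_integrable_compact_support[of _ K] continuous_on_subset[OF c(2)]) auto
    have C1: "Ck_on (Suc 0) (\<psi> k) \<Omega>"
    proof -
      have "Ck_on (Suc 0) (\<psi> k) UNIV" using \<psi>[of k] by (metis test_function_def)
      then show ?thesis by (auto intro: continuous_on_subset)
    qed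
    have "has_weak_grad \<Omega> (\<lambda>x. \<phi> x + - 1 * \<psi> k x) (\<lambda>x. ?P x + - 1 *\<^sub>R grad (\<psi> k) x)"
      by (intro has_weak_grad_add has_weak_grad_scaleR has_weak_grad_grad[OF \<Omega> C1] P)
    then have "AE x in lebesgue. x \<in> \<Omega> \<longrightarrow> weak_grad \<Omega> (\<lambda>x. \<phi> x - \<psi> k x) x = ?P x - grad (\<psi> k) x"
      using weak_grad_AE_eq[OF \<Omega>] by simp
    then have AE: "AE x in lebesgue. indicator \<Omega> x *\<^sub>R norm (?P x - grad (\<psi> k) x) =
        indicator \<Omega> x *\<^sub>R norm (weak_grad \<Omega> (\<lambda>x. \<phi> x - \<psi> k x) x)"
      by eventually_elim (auto simp: indicator_def)
    have diff: "set_integrable lebesgue \<Omega> (\<lambda>x. ?P x - grad (\<psi> k) x)"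
      using P(1) int by (rule set_integral_diff)
    have "(LINT x:\<Omega>|lebesgue. N x \<bullet> ?P x) =
        (LINT x:\<Omega>|lebesgue. N x \<bullet> ?P x) - (LINT x:\<Omega>|lebesgue. N x \<bullet> grad (\<psi> k) x)"
      using integral_N_grad[OF \<psi>] by simp
    also have "\<dots> = (LINT x:\<Omega>|lebesgue. N x \<bullet> (?P x - grad (\<psi> k) x))"
      using set_integral_diff(2)[OF set_integrable_N_inner(1)[OF P(1)] set_integrable_N_inner(1)[OF int]]
      by (simp add: inner_diff_right)
    finally have "\<bar>LINT x:\<Omega>|lebesgue. N x \<bullet> ?P x\<bar> \<le> (LINT x:\<Omega>|lebesgue. norm (?P x - grad (\<psi> k) x))"
      using set_integrable_N_inner(2)[OF diff] by simp
    also have "\<dots> = (LINT x:\<Omega>|lebesgue. norm (weak_grad \<Omega> (\<lambda>x. \<phi> x - \<psi> k x) x))"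
      using set_integrable_norm[OF diff] AE unfolding set_integrable_def
      by (intro set_lebesgue_integral_cong_AE_lebesgue[symmetric] borel_measurable_integrable)
    also have "\<dots> \<le> W11_norm \<Omega> (\<lambda>x. \<phi> x - \<psi> k x)"
      by (simp add: W11_norm_def set_lebesgue_integral_def)
    finally show ?thesis .
  qed
  then have "\<bar>LINT x:\<Omega>|lebesgue. N x \<bullet> ?P x\<bar> \<le> 0"
    using lim by (intro LIMSEQ_le_const[OF lim]) auto
  then show ?thesis by simp
qed

lemma is_minimizer_u:
  assumes bounded: "bounded \<Omega>" and u: "u \<in> W11 \<Omega>"
  shows "is_minimizer \<Omega> u"
  unfolding is_minimizer_def
proof (intro conjI ballI u)
  fix \<phi> assume \<phi>: "\<phi> \<in> W11_0 \<Omega>"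
  let ?P = "weak_grad \<Omega> \<phi>" and ?W = "weak_grad \<Omega> u" and ?V = "weak_grad \<Omega> (\<lambda>x. u x + \<phi> x)"
  have P: "set_integrable lebesgue \<Omega> ?P" "has_weak_grad \<Omega> \<phi> ?P"
    using \<phi> has_weak_grad_weak_grad[of \<Omega> \<phi>] unfolding W11_0_def W11_def by blast+
  have V: "AE x in lebesgue. x \<in> \<Omega> \<longrightarrow> ?V x = grad u x + ?P x"
    by (rule weak_grad_AE_eq[OF \<Omega> has_weak_grad_add[OF has_weak_grad_u P(2)]])
  \<comment> \<open>Boundedness of \<Omega> enters here through the compact closure. It makes
    \<open>F\<close> integrable, so the energies compared below are genuine integrals and not the
    default value 0.\<close>
  have "X_star absolutely_integrable_on closure \<Omega>"
    using locally_integrable_on_continuous[OF linear_continuous_on[OF linear_X_star[unfolded linear_conv_bounded_linear]], of "closure \<Omega>"]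
      bounded by (simp add: locally_integrable_on_def compact_closure)
  then have "set_integrable lebesgue \<Omega> X_star"
    by (rule set_integrable_subset) (use \<Omega> closure_subset in auto)
  moreover have "set_integrable lebesgue \<Omega> ?W"
    using u by (simp add: W11_def)
  ultimately have "set_integrable lebesgue \<Omega> (\<lambda>x. ?W x - X_star x)"
    by (intro set_integral_diff(1))
  then have F: "set_integrable lebesgue \<Omega> F"
    by (rule set_integrable_cong_AE_lebesgue)
      (use weak_grad_u_AE in eventually_elim, auto simp: F_def)
  have FP: "set_integrable lebesgue \<Omega> (\<lambda>x. F x + ?P x)"
    using F P(1) by (rule set_integral_add)
  have NP: "set_integrable lebesgue \<Omega> (\<lambda>x. N x \<bullet> ?P x)"
    by (rule set_integrable_N_inner(1)[OF P(1)])
  have "X_energy \<Omega> u = (LINT x:\<Omega>|lebesgue. norm (F x))"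
    unfolding X_energy_def
  proof (rule set_lebesgue_integral_cong_AE_lebesgue)
    show "(\<lambda>x. indicator \<Omega> x *\<^sub>R norm (F x)) \<in> borel_measurable lebesgue"
      using set_integrable_norm[OF F] unfolding set_integrable_def by (rule borel_measurable_integrable)
    show "AE x in lebesgue. indicator \<Omega> x *\<^sub>R norm (F x) = indicator \<Omega> x *\<^sub>R norm (?W x - X_star x)"
      using weak_grad_u_AE by eventually_elim (auto simp: indicator_def F_def)
  qed
  also have "\<dots> = (LINT x:\<Omega>|lebesgue. norm (F x) + N x \<bullet> ?P x)"
    using set_integral_add(2)[OF set_integrable_norm[OF F] NP] integral_N_W11_0[OF \<phi>] by simp
  also have "\<dots> \<le> (LINT x:\<Omega>|lebesgue. norm (F x + ?P x))"
  proof (rule set_integral_mono)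
    show "norm (F x) + N x \<bullet> ?P x \<le> norm (F x + ?P x)" for x
    proof -
      have "norm (F x) + N x \<bullet> ?P x = N x \<bullet> (F x + ?P x)"
        by (simp add: inner_add_right N_inner_F)
      also have "\<dots> \<le> norm (N x) * norm (F x + ?P x)"
        by (rule norm_cauchy_schwarz)
      also have "\<dots> \<le> 1 * norm (F x + ?P x)"
        by (intro mult_right_mono norm_N_le norm_ge_zero)
      finally show ?thesis by simp
    qed
  qed (intro set_integral_add set_integrable_norm F NP FP)+
  also have "\<dots> = X_energy \<Omega> (\<lambda>x. u x + \<phi> x)"
    unfolding X_energy_def
  proof (rule set_lebesgue_integral_cong_AE_lebesgue[symmetric])
    show "(\<lambda>x. indicator \<Omega> x *\<^sub>R norm (F x + ?P x)) \<in> borel_measurable lebesgue"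
      using set_integrable_norm[OF FP] unfolding set_integrable_def by (rule borel_measurable_integrable)
    show "AE x in lebesgue. indicator \<Omega> x *\<^sub>R norm (F x + ?P x) = indicator \<Omega> x *\<^sub>R norm (?V x - X_star x)"
      using V by eventually_elim (auto simp: indicator_def F_def algebra_simps)
  qed
  finally show "X_energy \<Omega> u \<le> X_energy \<Omega> (\<lambda>x. u x + \<phi> x)" .
qed

end

theorem corollaryF:
  fixes \<Omega> :: "(real^2^'n) set" and u :: "real^2^'n \<Rightarrow> real"
  assumes "CARD('n) \<ge> 2"
    and "open \<Omega>" and "connected \<Omega>" and "\<Omega> \<noteq> {}" and "bounded \<Omega>"
    and "continuous_on (closure \<Omega>) u"
    and "C2_solution \<Omega> u"
  shows "weak_solution \<Omega> u \<and> (u \<in> W11 \<Omega> \<longrightarrow> is_minimizer \<Omega> u)"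
proof -
  interpret C2_p_minimal \<Omega> u
    by unfold_locales (use assms in auto)
  show ?thesis
    using weak_solution_u is_minimizer_u[OF \<open>bounded \<Omega>\<close>] by blast
qed

end
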